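(* For every integer $n>1$ let $(u_k)_{k=0}^n$ and $(\overline u_k)_{k=0}^n$, with $u_k,\overline u_k\in D(B)$, be solutions of the nonlinear three-layer scheme $$\frac{u_{k+1}-2u_k+u_{k-1}}{\tau^2}+a_1B\frac{u_{k+1}-u_{k-1}}{2\tau}+a_2B\frac{u_{k+1}+u_{k-1}}{2}+\left(a_{1,k}+d_k\right)A\frac{u_{k+1}+u_{k-1}}{2}+a_{3,k}\frac{u_{k+1}+u_{k-1}}{2}+Cu_k+N\frac{u_{k+1}-u_{k-1}}{2\tau}+M(u_k)=f_k,\qquad k=1,\ldots,n-1,$$ $\tau=\overline t/n$, corresponding to the initial vectors $(u_0,u_1,f_k)$ and $(\overline u_0,\overline u_1,\overline f_k)$ respectively, whose components are sufficiently smooth (in the sense given in the context). Then there is a positive constant $c$ (independent of $n$ and $k$) such that for $z_k=u_k-\overline u_k$ and $\Delta z_k=z_{k+1}-z_k$, $$\|B^{1/2}z_{k+1}\|+\left\|\frac{\Delta z_k}{\tau}\right\|\le c\left(\|B^{1/2}z_0\|+\left\|\frac{\Delta z_0}{\tau}\right\|+\tau\left\|B^{1/2}\frac{\Delta z_0}{\tau}\right\|+\tau\sum_{i=1}^k\|f_i-\overline f_i\|\right),\qquad k=1,\ldots,n-1.$$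
   Context: Setting. $H$ is a Hilbert space with inner product $(\cdot,\cdot)$ and norm $\|\cdot\|$; $\overline t>0$. $A$ and $B$ are self-adjoint, positively defined (i.e. $(Au,u)\ge m_A\|u\|^2$ on $D(A)$ and $(Bu,u)\ge m_B\|u\|^2$ on $D(B)$ for some constants $m_A,m_B>0$), generally unbounded operators with domains $D(A)$, $D(B)$ dense in $H$, $D(B)\subset D(A)$, and there is a constant $b_0>0$ with $\|Au\|^2\le b_0^2(Bu,u)$ for all $u\in D(B)$. $\psi_1,\psi_2,\psi_3:[0,+\infty[\to[0,+\infty[$ are twice continuously differentiable nonnegative functions and $\psi_2$ is increasing. $C$ is a linear operator with $D(A)\subset D(C)$ and $\|Cu\|\le a_0\|Au\|$ for all $u\in D(A)$, where $a_0>0$ is a constant. $N$ is a bounded linear operator on $H$. $M:H\to H$ is a (nonlinear) operator satisfying a Lipschitz condition. $a_1,a_2>0$ are constants. Coefficients of the scheme. For $j=1,3$, $$\widetilde\psi_j(a,b)=\frac1{b-a}\int_a^b\psi_j(s)\,ds\quad(a\ne b),\qquad \widetilde\psi_j(a,a)=\psi_j(a),$$ and $$\gamma_k=\|A^{1/2}u_k\|^2,\quad a_{1,k}=\widetilde\psi_1(\gamma_{k-1},\gamma_{k+1}),\quad d_k=\frac{\psi_2(\gamma_{k+1})-\psi_2(\gamma_{k-1})}{2\tau},\quad a_{3,k}=\widetilde\psi_3\left(\|u_{k-1}\|^2,\|u_{k+1}\|^2\right).$$ For the solution $\overline u_k$ the coefficients are formed in the same way from $\overline u_k$, and the right-hand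 side is $\overline f_k$. Data. "Sufficiently smooth" means that $u_0,u_1,\overline u_0,\overline u_1\in D(B)$, $f_k,\overline f_k\in H$, and that $\|B^{1/2}u_0\|$, $\|B^{1/2}u_1\|$, $\|(u_1-u_0)/\tau\|$, $\max_k\|f_k\|$ and the corresponding quantities for the barred data are bounded independently of $n$.
   Formalization: The estimate is proved for all sufficiently large n (small τ) instead of every n>1; for coarse steps it fails, e.g. H=R, A=B=I, N=-6I, C=M=0, ψ2(s)=s, ψ1=ψ3=0, a1=a2=1, τ=1, n=2: (0,0,2) and (0,0,0) both solve the scheme with f=0. *)

theory Defs
  imports "HOL-Analysis.Analysis"
begin

text \<open>
  An unbounded operator is a pair of a domain and a function; the values of the function outside
  the domain are irrelevant. The scalars are real; a complex Hilbert space is covered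
  through its underlying real Hilbert space with the real part of the inner product.
\<close>

definition linear_operator :: "'a::real_vector set \<Rightarrow> ('a \<Rightarrow> 'a) \<Rightarrow> bool" where
  "linear_operator D T \<longleftrightarrow> subspace D \<and>
     (\<forall>x\<in>D. \<forall>y\<in>D. T (x + y) = T x + T y) \<and> (\<forall>r. \<forall>x\<in>D. T (r *\<^sub>R x) = r *\<^sub>R T x)"

text \<open>For a densely defined operator this is the graph of its adjoint.\<close>

definition adjoint_graph :: "'a::real_inner set \<Rightarrow> ('a \<Rightarrow> 'a) \<Rightarrow> ('a \<times> 'a) set" where
  "adjoint_graph D T = {(y, z). \<forall>x\<in>D. inner (T x) y = inner x z}"

definition self_adjoint :: "'a::real_inner set \<Rightarrow> ('a \<Rightarrow> 'a) \<Rightarrow> bool" where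
  "self_adjoint D T \<longleftrightarrow>
     linear_operator D T \<and> closure D = UNIV \<and> adjoint_graph D T = (\<lambda>x. (x, T x)) ` D"

definition positively_defined :: "'a::real_inner set \<Rightarrow> ('a \<Rightarrow> 'a) \<Rightarrow> bool" where
  "positively_defined D T \<longleftrightarrow> (\<exists>m>0. \<forall>u\<in>D. inner (T u) u \<ge> m * (norm u)\<^sup>2)"

definition is_sqrt_operator ::
  "'a::real_inner set \<Rightarrow> ('a \<Rightarrow> 'a) \<Rightarrow> 'a set \<Rightarrow> ('a \<Rightarrow> 'a) \<Rightarrow> bool" where
  "is_sqrt_operator D T E S \<longleftrightarrow>
     self_adjoint E S \<and> (\<forall>x\<in>E. inner (S x) x \<ge> 0) \<and>
     D = {x\<in>E. S x \<in> E} \<and> (\<forall>x\<in>D. S (S x) = T x)"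

text \<open>
  The nonnegative self-adjoint square root is unique on its domain, which contains \<open>D\<close>;
  the choice operator only picks the irrelevant values outside that domain.
\<close>

definition sqrt_operator :: "'a::real_inner set \<Rightarrow> ('a \<Rightarrow> 'a) \<Rightarrow> 'a \<Rightarrow> 'a" where
  "sqrt_operator D T = (SOME S. \<exists>E. is_sqrt_operator D T E S)"

definition C2_on :: "real set \<Rightarrow> (real \<Rightarrow> real) \<Rightarrow> bool" where
  "C2_on S \<psi> \<longleftrightarrow> (\<exists>\<psi>' \<psi>''.
     (\<forall>s\<in>S. (\<psi> has_real_derivative \<psi>' s) (at s within S)) \<and>
     (\<forall>s\<in>S. (\<psi>' has_real_derivative \<psi>'' s) (at s within S)) \<and>
     continuous_on S \<psi>'')"

text \<open>The interval integral is oriented, so \<open>b < a\<close> is allowed.\<close>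

definition integral_mean :: "(real \<Rightarrow> real) \<Rightarrow> real \<Rightarrow> real \<Rightarrow> real" where
  "integral_mean \<psi> a b =
     (if a = b then \<psi> a else 1 / (b - a) * (LBINT s=ereal a..ereal b. \<psi> s))"

definition gamma_coeff ::
  "'a::real_inner set \<Rightarrow> ('a \<Rightarrow> 'a) \<Rightarrow> (nat \<Rightarrow> 'a) \<Rightarrow> nat \<Rightarrow> real" where
  "gamma_coeff DA A u k = (norm (sqrt_operator DA A (u k)))\<^sup>2"

definition a1_coeff ::
  "(real \<Rightarrow> real) \<Rightarrow> 'a::real_inner set \<Rightarrow> ('a \<Rightarrow> 'a) \<Rightarrow> (nat \<Rightarrow> 'a) \<Rightarrow> nat \<Rightarrow> real" where
  "a1_coeff \<psi>1 DA A u k =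
     integral_mean \<psi>1 (gamma_coeff DA A u (k - 1)) (gamma_coeff DA A u (k + 1))"

definition d_coeff ::
  "(real \<Rightarrow> real) \<Rightarrow> real \<Rightarrow> 'a::real_inner set \<Rightarrow> ('a \<Rightarrow> 'a) \<Rightarrow> (nat \<Rightarrow> 'a) \<Rightarrow> nat \<Rightarrow> real" where
  "d_coeff \<psi>2 \<tau> DA A u k =
     (\<psi>2 (gamma_coeff DA A u (k + 1)) - \<psi>2 (gamma_coeff DA A u (k - 1))) / (2 * \<tau>)"

definition a3_coeff :: "(real \<Rightarrow> real) \<Rightarrow> (nat \<Rightarrow> 'a::real_inner) \<Rightarrow> nat \<Rightarrow> real" where
  "a3_coeff \<psi>3 u k = integral_mean \<psi>3 ((norm (u (k - 1)))\<^sup>2) ((norm (u (k + 1)))\<^sup>2)"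

text \<open>The left-hand side of the scheme at layer \<open>k \<ge> 1\<close>.\<close>

definition scheme_lhs ::
  "(real \<Rightarrow> real) \<Rightarrow> (real \<Rightarrow> real) \<Rightarrow> (real \<Rightarrow> real) \<Rightarrow> real \<Rightarrow> real \<Rightarrow> 'a::real_inner set \<Rightarrow>
   ('a \<Rightarrow> 'a) \<Rightarrow> ('a \<Rightarrow> 'a) \<Rightarrow> ('a \<Rightarrow> 'a) \<Rightarrow> ('a \<Rightarrow> 'a) \<Rightarrow> ('a \<Rightarrow> 'a) \<Rightarrow>
   real \<Rightarrow> (nat \<Rightarrow> 'a) \<Rightarrow> nat \<Rightarrow> 'a" where
  "scheme_lhs \<psi>1 \<psi>2 \<psi>3 a1 a2 DA A B C N M \<tau> u k =
     (u (k + 1) - 2 *\<^sub>R u k + u (k - 1)) /\<^sub>R \<tau>\<^sup>2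
     + a1 *\<^sub>R B ((u (k + 1) - u (k - 1)) /\<^sub>R (2 * \<tau>))
     + a2 *\<^sub>R B ((u (k + 1) + u (k - 1)) /\<^sub>R 2)
     + (a1_coeff \<psi>1 DA A u k + d_coeff \<psi>2 \<tau> DA A u k) *\<^sub>R A ((u (k + 1) + u (k - 1)) /\<^sub>R 2)
     + a3_coeff \<psi>3 u k *\<^sub>R ((u (k + 1) + u (k - 1)) /\<^sub>R 2)
     + C (u k) + N ((u (k + 1) - u (k - 1)) /\<^sub>R (2 * \<tau>)) + M (u k)"

text \<open>In \<open>u n k\<close> the first index is the number of time steps, the second one the layer.\<close>

definition solves_scheme ::
  "(real \<Rightarrow> real) \<Rightarrow> (real \<Rightarrow> real) \<Rightarrow> (real \<Rightarrow> real) \<Rightarrow> real \<Rightarrow> real \<Rightarrow> 'a::real_inner set \<Rightarrow>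
   ('a \<Rightarrow> 'a) \<Rightarrow> 'a set \<Rightarrow> ('a \<Rightarrow> 'a) \<Rightarrow> ('a \<Rightarrow> 'a) \<Rightarrow> ('a \<Rightarrow> 'a) \<Rightarrow> ('a \<Rightarrow> 'a) \<Rightarrow>
   real \<Rightarrow> (nat \<Rightarrow> nat \<Rightarrow> 'a) \<Rightarrow> (nat \<Rightarrow> nat \<Rightarrow> 'a) \<Rightarrow> bool" where
  "solves_scheme \<psi>1 \<psi>2 \<psi>3 a1 a2 DA A DB B C N M T u f \<longleftrightarrow>
     (\<forall>n>1. (\<forall>k\<le>n. u n k \<in> DB) \<and>
       (\<forall>k\<in>{1..n - 1}.
          scheme_lhs \<psi>1 \<psi>2 \<psi>3 a1 a2 DA A B C N M (T / real n) (u n) k = f n k))"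

definition bounded_data ::
  "'a::real_inner set \<Rightarrow> ('a \<Rightarrow> 'a) \<Rightarrow> real \<Rightarrow> (nat \<Rightarrow> nat \<Rightarrow> 'a) \<Rightarrow> (nat \<Rightarrow> nat \<Rightarrow> 'a) \<Rightarrow> bool" where
  "bounded_data DB B T u f \<longleftrightarrow>
     (\<exists>K. \<forall>n>1.
        norm (sqrt_operator DB B (u n 0)) \<le> K \<and>
        norm (sqrt_operator DB B (u n 1)) \<le> K \<and>
        norm ((u n 1 - u n 0) /\<^sub>R (T / real n)) \<le> K \<and>
        (\<forall>k\<in>{1..n - 1}. norm (f n k) \<le> K))"

end

theory Submission
  imports Defs
begin

text \<open>
  Testing the scheme with \<open>u (k + 1) - u (k - 1)\<close> turns the inertia and stiffness terms into
  differences of a discrete energy. The coefficients are chosen so that the same happens to the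
  terms with \<open>\<psi>1\<close> and \<open>\<psi>3\<close> (the integral mean times the increment of its argument is an increment
  of the primitive), while the \<open>\<psi>2\<close> term is dissipative by monotonicity. With a discrete Gronwall
  inequality this bounds the solutions independently of \<open>n\<close>. On the bounded set so obtained, all
  lower order terms are Lipschitz with respect to the energy, because \<open>A\<close> is dominated by
  \<open>B\<^sup>1\<^sup>/\<^sup>2\<close>; hence the difference of two solutions satisfies a linear energy inequality, to which
  the same argument applies. Both uses of Gronwall need a small time step, that is, large \<open>n\<close>.

  As \<open>sqrt_operator\<close> is a choice, one must also prove that the square root of a positive definite
  self-adjoint operator exists; it is the inverse of the square root of the bounded inverse.
\<close>

section \<open>Square roots of positive definite self-adjoint operators\<close>

text \<open>The delicate term is the one with \<open>d_coeff\<close>: it is divided by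
  \<open>\<tau>\<close>, so a Lipschitz bound uniform in the time step is not visible. The increment
  of \<open>\<psi>2\<close> is an integral mean of its derivative times the increment of
  \<open>\<gamma>\<close>, and the latter is the inner product of
  \<open>A (u (k + 1) + u (k - 1))\<close> with \<open>u (k + 1) - u (k - 1)\<close>. The division
  then falls on the central difference, which the energy controls. For this reason the a priori
  bound includes the velocities, and the second derivative of \<open>\<psi>2\<close> enters.

  The energy structure behind the a priori bound does not survive subtraction, since the two
  solutions have different coefficients. For the difference all nonlinear terms are moved to the
  right-hand side, and only inertia and \<open>B\<close> contribute to the energy. Both estimates
  concern the square root of the energy, so that the data enter through their norms and not through
  squares.

  Of the square root of \<open>B\<close> only two facts are used: its linearity on \<open>DB\<close>
  and its norm there, given by the quadratic form of \<open>B\<close>.\<close>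

text \<open>Every point has a nearest point in \<open>V\<close>, by completeness, and the residual
  is orthogonal to \<open>V\<close>, hence zero. This yields surjectivity of coercive operators and
  density of the domain of an inverse.\<close>

lemma closed_subspace_eq_UNIV:
  fixes V :: "'a::{real_inner, banach} set"
  assumes "closed V" "subspace V"
    and orth: "\<And>y. (\<And>x. x \<in> V \<Longrightarrow> inner x y = 0) \<Longrightarrow> y = 0"
  shows "V = UNIV"
proof -
  have "p \<in> V" for p
  proof -
    define d where "d = infdist p V"
    have ne: "V \<noteq> {}" using \<open>subspace V\<close> subspace_0 by blast
    have d0: "d \<ge> 0" unfolding d_def by (rule infdist_nonneg)
    have dle: "d\<^sup>2 \<le> (norm (p - x))\<^sup>2" if "x \<in> V" for x
      using infdist_le[OF that, of p] d0 unfolding d_def dist_norm by (intro power_mono) auto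
    have "\<exists>x\<in>V. (norm (p - x))\<^sup>2 < d\<^sup>2 + 1 / real (Suc n)" for n
    proof -
      have "d < sqrt (d\<^sup>2 + 1 / real (Suc n))"
        using d0 by (intro real_less_rsqrt) auto
      then obtain x where "x \<in> V" "dist p x < sqrt (d\<^sup>2 + 1 / real (Suc n))"
        unfolding d_def infdist_notempty[OF ne] using cINF_less_iff[OF ne] bdd_below_image_dist by metis
      moreover from this have "(norm (p - x))\<^sup>2 < (sqrt (d\<^sup>2 + 1 / real (Suc n)))\<^sup>2"
        by (intro power_strict_mono) (auto simp: dist_norm)
      ultimately show ?thesis by (auto simp: add_nonneg_nonneg)
    qed
    then obtain v where v: "\<And>n. v n \<in> V" "\<And>n. (norm (p - v n))\<^sup>2 < d\<^sup>2 + 1 / real (Suc n)"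
      by metis
    have par: "(norm (v m - v n))\<^sup>2 \<le> 2 / real (Suc m) + 2 / real (Suc n)" for m n
    proof -
      \<comment> \<open>The midpoint also lies in \<open>V\<close>, so its distance to
        \<open>p\<close> is at least \<open>d\<close>; the parallelogram identity turns this into a
        Cauchy estimate for the minimising sequence.\<close>
      have "(1/2) *\<^sub>R (v m + v n) \<in> V"
        using \<open>subspace V\<close> v by (simp add: subspace_add subspace_scale)
      from dle[OF this]
      have "4 * d\<^sup>2 \<le> 4 * (norm (p - (1/2) *\<^sub>R (v m + v n)))\<^sup>2" by simp
      also have "\<dots> = 2 * (norm (p - v m))\<^sup>2 + 2 * (norm (p - v n))\<^sup>2 - (norm (v m - v n))\<^sup>2"
        by (simp add: power2_norm_eq_inner inner_simps inner_commute algebra_simps)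
      finally show ?thesis using v(2)[of m] v(2)[of n] by simp
    qed
    have "Cauchy v"
    proof (rule metric_CauchyI)
      fix e :: real assume "e > 0"
      then obtain K where K: "inverse (real (Suc K)) < e\<^sup>2 / 4"
        using reals_Archimedean[of "e\<^sup>2 / 4"] by auto
      show "\<exists>K. \<forall>m\<ge>K. \<forall>n\<ge>K. dist (v m) (v n) < e"
      proof (intro exI[of _ K] allI impI)
        fix m n assume mn: "K \<le> m" "K \<le> n"
        have "1 / real (Suc m) \<le> inverse (real (Suc K))" "1 / real (Suc n) \<le> inverse (real (Suc K))"
          using mn by (auto simp: inverse_eq_divide divide_simps)
        then have "(norm (v m - v n))\<^sup>2 < e\<^sup>2" using par[of m n] K by simp
        then show "dist (v m) (v n) < e"
          using \<open>e > 0\<close> by (simp add: dist_norm power_less_imp_less_base)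
      qed
    qed
    then obtain w where w: "v \<longlonglongrightarrow> w" by (auto simp: Cauchy_convergent_iff convergent_def)
    have wV: "w \<in> V" using closed_sequentially[OF \<open>closed V\<close>] v(1) w by blast
    have wd: "(norm (p - w))\<^sup>2 \<le> d\<^sup>2"
    proof (rule LIMSEQ_le)
      show "(\<lambda>n. (norm (p - v n))\<^sup>2) \<longlonglongrightarrow> (norm (p - w))\<^sup>2" by (intro tendsto_intros w)
      show "(\<lambda>n. d\<^sup>2 + 1 / real (Suc n)) \<longlonglongrightarrow> d\<^sup>2"
        using tendsto_add[OF tendsto_const[of "d\<^sup>2"] LIMSEQ_inverse_real_of_nat]
        by (simp add: inverse_eq_divide)
      show "\<exists>N. \<forall>n\<ge>N. (norm (p - v n))\<^sup>2 \<le> d\<^sup>2 + 1 / real (Suc n)"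
        using v(2) less_imp_le by blast
    qed
    have "p - w = 0"
    proof (rule orth)
      fix x assume x: "x \<in> V"
      show "inner x (p - w) = 0"
      proof (cases "x = 0")
        case False
        \<comment> \<open>This \<open>t\<close> minimises the distance from \<open>p\<close> to the
          line through \<open>w\<close> in direction \<open>x\<close>; a nonzero inner product would
          give a point of \<open>V\<close> closer than \<open>w\<close>.\<close>
        define t where "t = inner x (p - w) / inner x x"
        have "w + t *\<^sub>R x \<in> V" using x wV \<open>subspace V\<close> by (simp add: subspace_add subspace_scale)
        from order_trans[OF wd dle[OF this]] have "(norm (p - w))\<^sup>2 \<le> (norm (p - w - t *\<^sub>R x))\<^sup>2"
          by (simp only: diff_diff_eq)
        also have "\<dots> = (norm (p - w))\<^sup>2 - 2 * t * inner x (p - w) + t\<^sup>2 * inner x x"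
          by (simp only: power2_norm_eq_inner) (simp add: inner_simps inner_commute algebra_simps power2_eq_square)
        also have "\<dots> = (norm (p - w))\<^sup>2 - (inner x (p - w))\<^sup>2 / inner x x"
          using False unfolding t_def by (simp add: power2_eq_square field_simps)
        finally have "(inner x (p - w))\<^sup>2 / inner x x \<le> 0" by simp
        then show ?thesis using False
          by (simp add: divide_le_0_iff not_le[THEN iffD2, OF inner_gt_zero_iff[THEN iffD2]])
      qed simp
    qed
    then show "p \<in> V" using wV by simp
  qed
  then show ?thesis by auto
qed

lemma self_adjoint_symmetric:
  assumes "self_adjoint D T" "x \<in> D" "y \<in> D"
  shows "inner (T x) y = inner x (T y)"
proof -
  have "(y, T y) \<in> adjoint_graph D T" using assms unfolding self_adjoint_def by auto
  then show ?thesis using assms(2) unfolding adjoint_graph_def by auto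
qed

text \<open>Self-adjointness includes maximality of the domain: the adjoint relation alone forces
  \<open>y\<close> into \<open>D\<close>. Closedness and kernel arguments below rest on
  this.\<close>

lemma self_adjoint_memI:
  assumes "self_adjoint D T" "\<And>x. x \<in> D \<Longrightarrow> inner (T x) y = inner x z"
  shows "y \<in> D \<and> T y = z"
proof -
  have "(y, z) \<in> adjoint_graph D T" using assms(2) unfolding adjoint_graph_def by auto
  then show ?thesis using assms(1) unfolding self_adjoint_def by auto
qed

lemma linear_operator_simps:
  assumes "linear_operator D T"
  shows "x \<in> D \<Longrightarrow> y \<in> D \<Longrightarrow> x + y \<in> D" "x \<in> D \<Longrightarrow> y \<in> D \<Longrightarrow> x - y \<in> D" "x \<in> D \<Longrightarrow> r *\<^sub>R x \<in> D"
    "0 \<in> D"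
    "x \<in> D \<Longrightarrow> y \<in> D \<Longrightarrow> T (x + y) = T x + T y" "x \<in> D \<Longrightarrow> T (r *\<^sub>R x) = r *\<^sub>R T x"
    "x \<in> D \<Longrightarrow> y \<in> D \<Longrightarrow> T (x - y) = T x - T y"
proof -
  note d = assms[unfolded linear_operator_def]
  show "x \<in> D \<Longrightarrow> y \<in> D \<Longrightarrow> x + y \<in> D" "x \<in> D \<Longrightarrow> y \<in> D \<Longrightarrow> x - y \<in> D" "x \<in> D \<Longrightarrow> r *\<^sub>R x \<in> D"
    "0 \<in> D" "x \<in> D \<Longrightarrow> y \<in> D \<Longrightarrow> T (x + y) = T x + T y" "x \<in> D \<Longrightarrow> T (r *\<^sub>R x) = r *\<^sub>R T x"
    using d by (auto simp: subspace_add subspace_scale subspace_0 subspace_diff)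
  assume xy: "x \<in> D" "y \<in> D"
  then have "T (x - y) = T (x + (-1) *\<^sub>R y)" by simp
  also have "\<dots> = T x + (-1) *\<^sub>R T y" using d xy by (metis subspace_scale)
  finally show "T (x - y) = T x - T y" by simp
qed

lemma norm_le_of_coercive:
  fixes x :: "'a::real_inner"
  assumes "m > 0" "m * (norm x)\<^sup>2 \<le> inner y x"
  shows "m * norm x \<le> norm y"
proof (cases "x = 0")
  case False
  have "m * norm x * norm x \<le> norm y * norm x"
    using assms(2) norm_cauchy_schwarz[of y x] by (simp add: power2_eq_square mult.assoc)
  then show ?thesis using False by simp
qed simp

text \<open>Coercivity makes preimages of a convergent sequence Cauchy, and the adjoint relation
  passes to their limit, so the range is closed. A vector orthogonal to the range lies in the
  kernel, which is trivial.\<close>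

lemma self_adjoint_coercive_surj:
  fixes T :: "'a::{real_inner, banach} \<Rightarrow> 'a"
  assumes sa: "self_adjoint D T" and "m > 0"
    and co: "\<And>u. u \<in> D \<Longrightarrow> m * (norm u)\<^sup>2 \<le> inner (T u) u"
  shows "T ` D = UNIV"
proof (rule closed_subspace_eq_UNIV)
  have lin: "linear_operator D T" using sa unfolding self_adjoint_def by blast
  note ls = linear_operator_simps[OF lin]
  show "subspace (T ` D)"
    unfolding subspace_def
  proof (intro conjI ballI allI)
    show "0 \<in> T ` D" using ls(4) ls(6)[OF ls(4), of 0] by (auto intro!: image_eqI[of _ T 0])
    show "x + y \<in> T ` D" if xy: "x \<in> T ` D" "y \<in> T ` D" for x y
    proof -
      obtain v w where "v \<in> D" "w \<in> D" "x = T v" "y = T w" using xy by blast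
      then have "x + y = T (v + w)" "v + w \<in> D" using ls by simp_all
      then show ?thesis by blast
    qed
    show "c *\<^sub>R x \<in> T ` D" if x: "x \<in> T ` D" for c x
    proof -
      obtain v where "v \<in> D" "x = T v" using x by blast
      then have "c *\<^sub>R x = T (c *\<^sub>R v)" "c *\<^sub>R v \<in> D" using ls by simp_all
      then show ?thesis by blast
    qed
  qed
  show "closed (T ` D)"
    unfolding closed_sequential_limits
  proof (intro allI impI, elim conjE)
    fix y l assume y: "\<forall>n. y n \<in> T ` D" and l: "y \<longlonglongrightarrow> l"
    then have "\<forall>n. \<exists>v. v \<in> D \<and> y n = T v" by blast
    then obtain x where x: "\<And>n. x n \<in> D" "\<And>n. y n = T (x n)" by metis
    have le: "norm (x i - x j) \<le> norm (y i - y j) / m" for i j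
      using norm_le_of_coercive[OF \<open>m > 0\<close> co[OF ls(2)[OF x(1) x(1)], of i j]] \<open>m > 0\<close>
      unfolding ls(7)[OF x(1) x(1)] x(2)[symmetric] by (simp add: field_simps)
    have "Cauchy x"
    proof (rule metric_CauchyI)
      fix e :: real assume "e > 0"
      have "Cauchy y" using l LIMSEQ_imp_Cauchy by blast
      then obtain K where K: "\<And>i j. i \<ge> K \<Longrightarrow> j \<ge> K \<Longrightarrow> dist (y i) (y j) < e * m"
        using metric_CauchyD[of y "e * m"] \<open>e > 0\<close> \<open>m > 0\<close> by auto
      show "\<exists>K. \<forall>i\<ge>K. \<forall>j\<ge>K. dist (x i) (x j) < e"
      proof (intro exI[of _ K] allI impI)
        fix i j assume "K \<le> i" "K \<le> j"
        then show "dist (x i) (x j) < e"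
          using le[of i j] K[of i j] \<open>m > 0\<close> unfolding dist_norm
          by (smt (verit) pos_divide_less_eq)
      qed
    qed
    then obtain w where w: "x \<longlonglongrightarrow> w" by (auto simp: Cauchy_convergent_iff convergent_def)
    have "w \<in> D \<and> T w = l"
    proof (rule self_adjoint_memI[OF sa])
      fix v assume "v \<in> D"
      have "(\<lambda>n. inner (T v) (x n)) \<longlonglongrightarrow> inner (T v) w" by (intro tendsto_intros w)
      moreover have "(\<lambda>n. inner (T v) (x n)) = (\<lambda>n. inner v (y n))"
        using self_adjoint_symmetric[OF sa \<open>v \<in> D\<close>] x by auto
      moreover have "(\<lambda>n. inner v (y n)) \<longlonglongrightarrow> inner v l" by (intro tendsto_intros l)
      ultimately show "inner (T v) w = inner v l" using LIMSEQ_unique by metis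
    qed
    then show "l \<in> T ` D" by blast
  qed
  fix y assume "\<And>x. x \<in> T ` D \<Longrightarrow> inner x y = 0"
  then have y: "y \<in> D \<and> T y = 0" by (intro self_adjoint_memI[OF sa]) auto
  then have "m * (norm y)\<^sup>2 \<le> 0" using co[of y] by simp
  then show "y = 0" using \<open>m > 0\<close> by (simp add: mult_le_0_iff)
qed

text \<open>The iteration is dominated by the scalar one for \<open>T = 0\<close>, which increases to \<open>1\<close>; so it
  converges in operator norm and no monotone convergence of operators is needed.\<close>

lemma bounded_square_root_exists:
  fixes T :: "'a::{real_inner, banach} \<Rightarrow> 'a"
  assumes T: "bounded_linear T"
    and sym: "\<And>x y. inner (T x) y = inner x (T y)"
    and le: "\<And>x. (norm (T x))\<^sup>2 \<le> inner (T x) x"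
  shows "\<exists>R. bounded_linear R \<and> (\<forall>x y. inner (R x) y = inner x (R y)) \<and>
    (\<forall>x. inner (R x) x \<ge> 0) \<and> (\<forall>x. R (R x) = T x)"
proof -
  \<comment> \<open>With \<open>R = I - L\<close> the equation \<open>R (R x) = T x\<close> becomes
    the fixed point equation \<open>L = (X + L L) / 2\<close>, which \<open>Y\<close> iterates from
    \<open>0\<close>.\<close>
  define X where "X = id_blinfun - Blinfun T"
  have X: "blinfun_apply X x = x - T x" for x
    unfolding X_def by (simp add: blinfun.diff_left bounded_linear_Blinfun_apply[OF T])
  have nX: "norm X \<le> 1"
  proof (rule norm_blinfun_bound)
    fix x
    have "(norm (x - T x))\<^sup>2 = (norm x)\<^sup>2 - 2 * inner (T x) x + (norm (T x))\<^sup>2"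
      by (simp add: power2_norm_eq_inner inner_simps inner_commute)
    also have "\<dots> \<le> (norm x)\<^sup>2" using le[of x] by (smt (verit) zero_le_power2)
    finally show "norm (blinfun_apply X x) \<le> 1 * norm x" using X by simp
  qed simp
  define Y where "Y = rec_nat (0 :: 'a \<Rightarrow>\<^sub>L 'a) (\<lambda>_ y. (1/2) *\<^sub>R (X + (y o\<^sub>L y)))"
  have Y0: "Y 0 = 0" and YS: "\<And>n. Y (Suc n) = (1/2) *\<^sub>R (X + (Y n o\<^sub>L Y n))"
    unfolding Y_def by simp_all
  define y where "y = rec_nat (0::real) (\<lambda>_ y. (1 + y * y) / 2)"
  have y0: "y 0 = 0" and yS: "\<And>n. y (Suc n) = (1 + y n * y n) / 2"
    unfolding y_def by simp_all
  have y01: "0 \<le> y n \<and> y n \<le> 1" for n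
    by (induction n) (auto simp: y0 yS mult_le_one)
  have yinc: "y n \<le> y (Suc n)" for n
  proof -
    have "0 \<le> (1 - y n)\<^sup>2" by simp
    then show ?thesis unfolding yS by (simp add: power2_eq_square algebra_simps)
  qed
  have Yy: "norm (Y n) \<le> y n" for n
  proof (induction n)
    case (Suc n)
    have "norm (X + (Y n o\<^sub>L Y n)) \<le> norm X + norm (Y n o\<^sub>L Y n)" by (rule norm_triangle_ineq)
    also have "\<dots> \<le> 1 + y n * y n"
      using nX norm_blinfun_compose[of "Y n" "Y n"] mult_mono[OF Suc.IH Suc.IH] y01[of n] by simp
    finally show ?case by (simp add: YS yS)
  qed (simp add: Y0 y0)
  have dY: "norm (Y (Suc n) - Y n) \<le> y (Suc n) - y n" for n
  proof (induction n)
    case 0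
    then show ?case using nX by (simp add: Y0 y0 YS yS)
  next
    case (Suc n)
    have comp: "norm (P o\<^sub>L Q) \<le> p * q" if "norm P \<le> p" "norm Q \<le> q" for P Q :: "'a \<Rightarrow>\<^sub>L 'a" and p q
      using norm_blinfun_compose[of P Q] mult_mono'[OF that] by simp
    \<comment> \<open>The difference of squares is split as \<open>P (P - Q) + (P - Q) Q\<close>,
      which holds without commutativity.\<close>
    have "Y (Suc (Suc n)) - Y (Suc n) =
      (1/2) *\<^sub>R ((Y (Suc n) o\<^sub>L (Y (Suc n) - Y n)) + ((Y (Suc n) - Y n) o\<^sub>L Y n))"
      by (intro blinfun_eqI)
        (simp add: YS[of "Suc n"] YS[of n] blinfun.bilinear_simps algebra_simps)
    then have "norm (Y (Suc (Suc n)) - Y (Suc n)) \<le>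
      (1/2) * (norm (Y (Suc n) o\<^sub>L (Y (Suc n) - Y n)) + norm ((Y (Suc n) - Y n) o\<^sub>L Y n))"
      by (simp add: norm_triangle_ineq)
    also have "\<dots> \<le> (1/2) * (y (Suc n) * (y (Suc n) - y n) + (y (Suc n) - y n) * y n)"
      using comp[OF Yy[of "Suc n"] Suc.IH] comp[OF Suc.IH Yy[of n]] by simp
    also have "\<dots> = y (Suc (Suc n)) - y (Suc n)"
      by (simp add: yS[of "Suc n"] yS[of n] field_simps)
    finally show ?case .
  qed
  have "Bseq y" using y01 by (intro BseqI'[of _ 1]) auto
  moreover have "monoseq y" using yinc by (simp add: monoseq_Suc)
  ultimately have "convergent y" by (rule Bseq_monoseq_convergent)
  \<comment> \<open>The increments of \<open>Y\<close> are dominated by the telescoping increments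
    of the convergent sequence \<open>y\<close>, so their series converges absolutely in the
    complete space of bounded operators.\<close>
  then have "summable (\<lambda>n. y (Suc n) - y n)"
    using telescope_summable unfolding convergent_def by blast
  then have "summable (\<lambda>n. Y (Suc n) - Y n)"
    by (rule summable_comparison_test'[where N = 0]) (rule dY)
  moreover have "(\<lambda>n. \<Sum>i<n. Y (Suc i) - Y i) = Y" by (simp add: sum_lessThan_telescope Y0)
  ultimately obtain L where L: "Y \<longlonglongrightarrow> L" unfolding summable_def sums_def by auto
  have "(\<lambda>n. Y (Suc n)) \<longlonglongrightarrow> (1/2) *\<^sub>R (X + (L o\<^sub>L L))"
    unfolding YS by (intro tendsto_intros bounded_bilinear.tendsto[OF bounded_bilinear_blinfun_compose] L)
  then have Leq: "L = (1/2) *\<^sub>R (X + (L o\<^sub>L L))" using LIMSEQ_Suc[OF L] LIMSEQ_unique by blast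
  have nL: "norm L \<le> 1"
  proof (rule Lim_bounded[OF tendsto_norm[OF L]])
    show "\<forall>n\<ge>0. norm (Y n) \<le> 1" using Yy y01 order_trans by blast
  qed
  have Ysym: "inner (Y n v) w = inner v (Y n w)" for n v w
    by (induction n arbitrary: v w)
      (simp_all add: Y0 YS blinfun.bilinear_simps X inner_simps sym)
  have Lsym: "inner (L v) w = inner v (L w)" for v w
  proof (rule LIMSEQ_unique)
    have *: "(\<lambda>n. Y n v) \<longlonglongrightarrow> L v" for v by (intro blinfun.tendsto L tendsto_const)
    show "(\<lambda>n. inner (Y n v) w) \<longlonglongrightarrow> inner (L v) w" by (intro tendsto_intros *)
    show "(\<lambda>n. inner (Y n v) w) \<longlonglongrightarrow> inner v (L w)" unfolding Ysym by (intro tendsto_intros *)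
  qed
  define R where "R = (\<lambda>x. x - L x)"
  have "bounded_linear R" unfolding R_def
    by (intro bounded_linear_sub bounded_linear_ident blinfun.bounded_linear_right)
  moreover have "inner (R x) y = inner x (R y)" for x y
    by (simp add: R_def inner_simps Lsym)
  moreover have "inner (R x) x \<ge> 0" for x
  proof -
    have "inner (L x) x \<le> norm (L x) * norm x" by (rule norm_cauchy_schwarz)
    also have "\<dots> \<le> norm x * norm x"
      using norm_blinfun[of L x] mult_right_mono[OF nL, of "norm x"] by (intro mult_right_mono) auto
    finally show ?thesis by (simp add: R_def inner_simps power2_norm_eq_inner[symmetric] power2_eq_square)
  qed
  moreover have "R (R x) = T x" for x
  proof -
    have "L x = (1/2) *\<^sub>R (x - T x + L (L x))"
      using arg_cong[OF Leq, of "\<lambda>Z. blinfun_apply Z x"] by (simp add: blinfun.bilinear_simps X)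
    then have "2 *\<^sub>R L x = x - T x + L (L x)" by (metis scaleR_half_double scaleR_2 scaleR_add_right)
    then show ?thesis by (simp add: R_def blinfun.bilinear_simps scaleR_2 algebra_simps)
  qed
  ultimately show ?thesis by blast
qed

section \<open>Passage from the bounded inverse to the unbounded square root\<close>

text \<open>If \<open>y\<close> is orthogonal to the range, testing with \<open>R (R y)\<close>
  gives \<open>R y = 0\<close> by symmetry, so injectivity gives density. If \<open>(y, z)\<close>
  is an adjoint pair, symmetry gives \<open>y = R z\<close>, so the adjoint has no larger
  domain.\<close>

lemma self_adjoint_inverse:
  fixes R :: "'a::{real_inner, banach} \<Rightarrow> 'a"
  assumes R: "linear R" "inj R" and sym: "\<And>x y. inner (R x) y = inner x (R y)"
  shows "self_adjoint (range R) (inv R)"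
proof -
  have sub: "subspace (range R)" using R(1) by (simp add: linear_subspace_image)
  have inv[simp]: "inv R (R x) = x" for x using R(2) by simp
  have "linear_operator (range R) (inv R)"
    using sub inv by (auto simp: linear_operator_def simp flip: linear_add[OF R(1)] linear_scale[OF R(1)])
  moreover have "closure (range R) = UNIV"
  proof (rule closed_subspace_eq_UNIV)
    show "subspace (closure (range R))"
      unfolding subspace_def
    proof (intro conjI ballI allI)
      show "0 \<in> closure (range R)" using sub closure_subset subspace_0 by blast
      show "x + y \<in> closure (range R)" if xy: "x \<in> closure (range R)" "y \<in> closure (range R)" for x y
      proof -
        obtain f g where "\<forall>n. f n \<in> range R" "f \<longlonglongrightarrow> x" "\<forall>n. g n \<in> range R" "g \<longlonglongrightarrow> y"
          using xy unfolding closure_sequential by blast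
        then show ?thesis unfolding closure_sequential
          using subspace_add[OF sub] by (intro exI[of _ "\<lambda>n. f n + g n"]) (auto intro: tendsto_add)
      qed
      show "c *\<^sub>R x \<in> closure (range R)" if x: "x \<in> closure (range R)" for c x
      proof -
        obtain f where "\<forall>n. f n \<in> range R" "f \<longlonglongrightarrow> x"
          using x unfolding closure_sequential by blast
        then show ?thesis unfolding closure_sequential
          using subspace_scale[OF sub]
          by (intro exI[of _ "\<lambda>n. c *\<^sub>R f n"]) (auto intro: tendsto_scaleR)
      qed
    qed
    fix y assume "\<And>x. x \<in> closure (range R) \<Longrightarrow> inner x y = 0"
    then have "inner (R (R y)) y = 0" using closure_subset by blast
    then have "inner (R y) (R y) = 0" unfolding sym .
    then have "R y = 0" by simp
    then show "y = 0" using R by (metis injD linear_0)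
  qed simp
  moreover have "adjoint_graph (range R) (inv R) = (\<lambda>x. (x, inv R x)) ` range R"
  proof (intro set_eqI iffI)
    fix p assume "p \<in> adjoint_graph (range R) (inv R)"
    then obtain y z where p: "p = (y, z)" "\<And>w. inner w y = inner (R w) z"
      by (auto simp: adjoint_graph_def)
    then have "inner (y - R z) (y - R z) = 0" by (simp add: sym inner_diff_right)
    then have "y = R z" by simp
    then show "p \<in> (\<lambda>x. (x, inv R x)) ` range R" using p by auto
  next
    fix p assume "p \<in> (\<lambda>x. (x, inv R x)) ` range R"
    then show "p \<in> adjoint_graph (range R) (inv R)" by (auto simp: adjoint_graph_def sym)
  qed
  ultimately show ?thesis unfolding self_adjoint_def by blast
qed

text \<open>With \<open>G\<close> the inverse of \<open>T\<close> and \<open>R\<close> its bounded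
  square root, the inverse of \<open>R\<close> on its range is the required operator. Its square has
  domain \<open>range (R o R) = range G = D\<close>.\<close>

lemma is_sqrt_operator_sqrt_operator:
  fixes T :: "'a::{real_inner, banach} \<Rightarrow> 'a"
  assumes sa: "self_adjoint D T" and pd: "positively_defined D T"
  shows "\<exists>E. is_sqrt_operator D T E (sqrt_operator D T)"
proof -
  obtain m where m: "m > 0" and co: "\<And>u. u \<in> D \<Longrightarrow> m * (norm u)\<^sup>2 \<le> inner (T u) u"
    using pd unfolding positively_defined_def by blast
  have lin: "linear_operator D T" using sa unfolding self_adjoint_def by blast
  note ls = linear_operator_simps[OF lin]
  have inj: "inj_on T D"
  proof (rule inj_onI)
    fix x y assume "x \<in> D" "y \<in> D" "T x = T y"
    then have "m * norm (x - y) \<le> 0" using norm_le_of_coercive[OF m co[of "x - y"]] ls by simp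
    then show "x = y" using m by (simp add: mult_le_0_iff)
  qed
  have "\<forall>y. \<exists>x\<in>D. T x = y" using self_adjoint_coercive_surj[OF sa m co] by (metis UNIV_I imageE)
  then obtain G where G: "\<And>y. G y \<in> D" "\<And>y. T (G y) = y" by metis
  have GT: "G (T x) = x" if "x \<in> D" for x using inj_onD[OF inj, of "G (T x)" x] G that by simp
  have blG: "bounded_linear G"
  proof (rule bounded_linear_intro)
    show "G (x + y) = G x + G y" for x y using GT[of "G x + G y"] G ls by simp
    show "G (r *\<^sub>R x) = r *\<^sub>R G x" for r x using GT[of "r *\<^sub>R G x"] G ls by simp
    show "norm (G x) \<le> norm x * (1 / m)" for x
      using norm_le_of_coercive[OF m co[OF G(1), of x]] G m by (simp add: field_simps)
  qed
  have Gsym: "inner (G x) y = inner x (G y)" for x y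
    using self_adjoint_symmetric[OF sa G(1) G(1), of x y] G(2) by simp
  \<comment> \<open>Coercivity at \<open>G x\<close> reads
    \<open>m * (norm (G x))\<^sup>2 \<le> inner x (G x)\<close>. Multiplied by \<open>m\<close>, it
    is the bound that the square root lemma asks of \<open>m G\<close>; the factor is removed again
    in \<open>R\<close>.\<close>
  have "\<exists>R. bounded_linear R \<and> (\<forall>x y. inner (R x) y = inner x (R y)) \<and>
    (\<forall>x. inner (R x) x \<ge> 0) \<and> (\<forall>x. R (R x) = m *\<^sub>R G x)"
  proof (rule bounded_square_root_exists)
    show "bounded_linear (\<lambda>x. m *\<^sub>R G x)" using blG by (rule bounded_linear_const_scaleR)
    show "inner (m *\<^sub>R G x) y = inner x (m *\<^sub>R G y)" for x y using Gsym by simp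
    show "(norm (m *\<^sub>R G x))\<^sup>2 \<le> inner (m *\<^sub>R G x) x" for x
      using mult_left_mono[OF co[OF G(1)], of m x] m G
      by (simp add: power_mult_distrib power2_eq_square inner_commute mult.left_commute)
  qed
  then obtain R0 where R0: "bounded_linear R0" "\<And>x y. inner (R0 x) y = inner x (R0 y)"
    "\<And>x. inner (R0 x) x \<ge> 0" "\<And>x. R0 (R0 x) = m *\<^sub>R G x" by blast
  define R where "R = (\<lambda>x. (1 / sqrt m) *\<^sub>R R0 x)"
  have R: "linear R" unfolding R_def
    using bounded_linear_const_scaleR[OF R0(1)] by (rule bounded_linear.linear)
  have Rsym: "inner (R x) y = inner x (R y)" for x y using R0(2) by (simp add: R_def)
  have RR: "R (R x) = G x" for x
    using m R0(4)[of x] unfolding R_def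
    by (simp add: linear_scale[OF bounded_linear.linear[OF R0(1)]])
  have injR: "inj R"
    by (intro injI) (metis RR G(2))
  have inv[simp]: "inv R (R x) = x" for x using injR by simp
  have "is_sqrt_operator D T (range R) (inv R)"
    unfolding is_sqrt_operator_def
  proof (intro conjI ballI)
    show "self_adjoint (range R) (inv R)" using R injR Rsym by (rule self_adjoint_inverse)
    show "0 \<le> inner (inv R x) x" if x: "x \<in> range R" for x
    proof -
      obtain w where "x = R w" using x by blast
      moreover have "inner w (R w) \<ge> 0" using R0(3)[of w] m by (simp add: R_def inner_commute)
      ultimately show ?thesis by simp
    qed
    show "D = {x \<in> range R. inv R x \<in> range R}"
    proof (intro set_eqI iffI)
      fix x assume "x \<in> D"
      then have "x = R (R (T x))" using RR GT by simp
      then show "x \<in> {x \<in> range R. inv R x \<in> range R}" by (metis (mono_tags) inv mem_Collect_eq rangeI)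
    next
      fix x assume "x \<in> {x \<in> range R. inv R x \<in> range R}"
      then obtain z where "x = R (R z)" by auto
      then show "x \<in> D" using RR G by simp
    qed
    show "inv R (inv R x) = T x" if "x \<in> D" for x
    proof -
      have "x = R (R (T x))" using RR GT that by simp
      then show ?thesis by (metis inv)
    qed
  qed
  \<comment> \<open>The witness makes the choice in \<open>sqrt_operator\<close> meaningful: the
    chosen operator is again a square root, though on a domain \<open>E\<close> that need not be
    named.\<close>
  then show ?thesis unfolding sqrt_operator_def
    using someI_ex[of "\<lambda>S. \<exists>E. is_sqrt_operator D T E S"] by blast
qed

text \<open>Moving one factor across by symmetry produces the square. The norm on \<open>D\<close>
  is thus fixed by the quadratic form of \<open>T\<close>, whichever square root was chosen.\<close>

lemma norm_sqrt_operator: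
  fixes T :: "'a::{real_inner, banach} \<Rightarrow> 'a"
  assumes "self_adjoint D T" "positively_defined D T" "x \<in> D"
  shows "(norm (sqrt_operator D T x))\<^sup>2 = inner (T x) x"
proof -
  obtain E where E: "is_sqrt_operator D T E (sqrt_operator D T)"
    using is_sqrt_operator_sqrt_operator assms by blast
  then have "x \<in> E" "sqrt_operator D T x \<in> E" "sqrt_operator D T (sqrt_operator D T x) = T x"
    using assms(3) unfolding is_sqrt_operator_def by auto
  then show ?thesis
    using self_adjoint_symmetric[of E "sqrt_operator D T" "sqrt_operator D T x" x] E
    unfolding is_sqrt_operator_def by (simp add: power2_norm_eq_inner)
qed

lemma sqrt_operator_linear:
  fixes T :: "'a::{real_inner, banach} \<Rightarrow> 'a"
  assumes "self_adjoint D T" "positively_defined D T"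
  shows "linear_operator D (sqrt_operator D T)"
proof -
  obtain E where E: "is_sqrt_operator D T E (sqrt_operator D T)"
    using is_sqrt_operator_sqrt_operator assms by blast
  then have "D \<subseteq> E" "linear_operator E (sqrt_operator D T)"
    unfolding is_sqrt_operator_def self_adjoint_def by auto
  then show ?thesis using assms(1) unfolding self_adjoint_def linear_operator_def by blast
qed

section \<open>Integral means\<close>

text \<open>The substitution puts all means on the fixed interval \<open>{0..1}\<close>. The
  quotient and the separate case \<open>a = b\<close> disappear, and the joint dependence on both
  endpoints becomes explicit.\<close>

lemma integral_mean_eq_integral:
  assumes cont: "continuous_on {0..} \<psi>" and ab: "0 \<le> a" "0 \<le> b"
  shows "((\<lambda>s. \<psi> (a + s * (b - a))) has_integral integral_mean \<psi> a b) {0..1}"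
proof (cases "a = b")
  case True
  then show ?thesis using has_integral_const_real[of "\<psi> a" 0 1] by (simp add: integral_mean_def)
next
  case False
  define R where "R = max a b"
  define F where "F x = integral {0..x} \<psi>" for x
  have contR: "continuous_on {0..R} \<psi>" using continuous_on_subset[OF cont] by auto
  have F: "(F has_real_derivative \<psi> x) (at x within {0..R})" if "x \<in> {0..R}" for x
    unfolding F_def using contR that by (rule integral_has_real_derivative)
  have "(LBINT s=ereal a..ereal b. \<psi> s) = F b - F a"
  proof (rule interval_integral_FTC_finite)
    show "continuous_on {min a b..max a b} \<psi>" using continuous_on_subset[OF cont] ab by auto
    fix x assume x: "min a b \<le> x" "x \<le> max a b"
    then have "(F has_real_derivative \<psi> x) (at x within {min a b..max a b})"
      using ab by (intro DERIV_subset[OF F]) (auto simp: R_def)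
    then show "(F has_vector_derivative \<psi> x) (at x within {min a b..max a b})"
      by (simp add: has_real_derivative_iff_has_vector_derivative)
  qed
  then have mean: "integral_mean \<psi> a b = F b / (b - a) - F a / (b - a)"
    using False by (simp add: integral_mean_def diff_divide_distrib)
  have line: "a + s * (b - a) \<in> {0..R}" if "s \<in> {0..1}" for s
  proof -
    have "a + s * (b - a) = (1 - s) * a + s * b" by (simp add: algebra_simps)
    moreover have "(1 - s) * a + s * b \<le> R" using that
      by (intro convex_bound_le) (auto simp: R_def)
    ultimately show ?thesis using that ab by simp
  qed
  have "((\<lambda>s. \<psi> (a + s * (b - a))) has_integral
    (F (a + 1 * (b - a)) / (b - a) - F (a + 0 * (b - a)) / (b - a))) {0..1}"
  proof (rule fundamental_theorem_of_calculus)
    fix s :: real assume s: "s \<in> {0..1}"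
    have "(F \<circ> (\<lambda>s. a + s * (b - a)) has_real_derivative \<psi> (a + s * (b - a)) * (b - a)) (at s within {0..1})"
    proof (rule DERIV_image_chain)
      show "(F has_real_derivative \<psi> (a + s * (b - a))) (at (a + s * (b - a)) within (\<lambda>s. a + s * (b - a)) ` {0..1})"
        using line by (intro DERIV_subset[OF F]) (use line[OF s] in auto)
      show "((\<lambda>s. a + s * (b - a)) has_real_derivative b - a) (at s within {0..1})"
        by (auto intro!: derivative_eq_intros)
    qed
    from DERIV_cdivide[OF this, of "b - a"] False
    show "((\<lambda>s. F (a + s * (b - a)) / (b - a)) has_vector_derivative \<psi> (a + s * (b - a))) (at s within {0..1})"
      by (simp add: has_real_derivative_iff_has_vector_derivative o_def)
  qed simp
  then show ?thesis using mean by simp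
qed

text \<open>The fundamental theorem in the division-free form that makes the scheme conservative; it
  covers both orientations, and for \<open>a = b\<close> both sides vanish whatever the default
  value of the mean.\<close>

lemma mult_integral_mean:
  assumes cont: "continuous_on {0..} \<psi>" and ab: "0 \<le> a" "0 \<le> b"
    and F: "\<And>s. 0 \<le> s \<Longrightarrow> (F has_real_derivative \<psi> s) (at s within {0..})"
  shows "(b - a) * integral_mean \<psi> a b = F b - F a"
proof -
  have "(LBINT s=ereal a..ereal b. \<psi> s) = F b - F a"
  proof (rule interval_integral_FTC_finite)
    show "continuous_on {min a b..max a b} \<psi>" using continuous_on_subset[OF cont] ab by auto
    fix x assume x: "min a b \<le> x" "x \<le> max a b"
    then have "(F has_real_derivative \<psi> x) (at x within {min a b..max a b})"
      using ab by (intro DERIV_subset[OF F]) auto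
    then show "(F has_vector_derivative \<psi> x) (at x within {min a b..max a b})"
      by (simp add: has_real_derivative_iff_has_vector_derivative)
  qed
  then show ?thesis by (simp add: integral_mean_def)
qed

text \<open>The nonnegative primitive will serve as potential energy.\<close>

lemma antiderivative_exists:
  assumes cont: "continuous_on {0..} (\<psi> :: real \<Rightarrow> real)" and nonneg: "\<And>s. 0 \<le> s \<Longrightarrow> 0 \<le> \<psi> s"
  shows "\<exists>F. (\<forall>s\<ge>0. (F has_real_derivative \<psi> s) (at s within {0..})) \<and> (\<forall>s\<ge>0. 0 \<le> F s)"
proof (intro exI conjI allI impI)
  let ?F = "\<lambda>x. integral {0..x} \<psi>"
  fix s :: real assume s: "0 \<le> s"
  have "(?F has_real_derivative \<psi> s) (at s within {0..s + 1})"
    using s by (intro integral_has_real_derivative continuous_on_subset[OF cont]) auto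
  \<comment> \<open>The differentiation theorem for integrals is applied on a compact interval;
    reaching beyond \<open>s\<close>, it has the same neighbourhoods of \<open>s\<close> as the
    half-line.\<close>
  moreover have "at s within {0..s + 1} = at s within {0..}"
    by (rule at_within_nhd[of s "{..<s + 1}"]) auto
  ultimately show "(?F has_real_derivative \<psi> s) (at s within {0..})" by simp
  show "0 \<le> ?F s" using nonneg s
    by (intro integral_nonneg integrable_continuous_real continuous_on_subset[OF cont]) auto
qed

text \<open>On \<open>{0..R}\<close> the function and its derivative are bounded by compactness, and
  all the segments stay inside this interval. The Lipschitz estimate therefore holds under the
  integral over \<open>{0..1}\<close>.\<close>

lemma integral_mean_bounded_Lipschitz:
  assumes d: "\<And>s. 0 \<le> s \<Longrightarrow> (\<psi> has_real_derivative \<psi>' s) (at s within {0..})"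
    and cont': "continuous_on {0..} \<psi>'"
  shows "\<exists>P>0. \<forall>a\<in>{0..R}. \<forall>b\<in>{0..R}. \<forall>a'\<in>{0..R}. \<forall>b'\<in>{0..R}. \<bar>integral_mean \<psi> a b\<bar> \<le> P \<and>
    \<bar>integral_mean \<psi> a b - integral_mean \<psi> a' b'\<bar> \<le> P * (\<bar>a - a'\<bar> + \<bar>b - b'\<bar>)"
proof -
  have cont: "continuous_on {0..} \<psi>"
    using d by (intro DERIV_continuous_on) auto
  have "bounded (\<psi> ` {0..R})" "bounded (\<psi>' ` {0..R})"
    using compact_continuous_image[OF continuous_on_subset[OF cont], of "{0..R}"]
      compact_continuous_image[OF continuous_on_subset[OF cont'], of "{0..R}"]
    by (auto intro: compact_imp_bounded)
  then obtain Q Q' where Q: "\<And>x. x \<in> {0..R} \<Longrightarrow> \<bar>\<psi> x\<bar> \<le> Q" and Q': "\<And>x. x \<in> {0..R} \<Longrightarrow> \<bar>\<psi>' x\<bar> \<le> Q'"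
    unfolding bounded_iff ball_simps real_norm_def by blast
  define P where "P = max 1 (max Q Q')"
  have P: "P > 0" "Q \<le> P" "Q' \<le> P" by (auto simp: P_def)
  have lip: "\<bar>\<psi> x - \<psi> y\<bar> \<le> P * \<bar>x - y\<bar>" if "x \<in> {0..R}" "y \<in> {0..R}" for x y
  proof -
    have "norm (\<psi> x - \<psi> y) \<le> P * norm (x - y)"
    proof (rule field_differentiable_bound)
      show "(\<psi> has_real_derivative \<psi>' z) (at z within {0..R})" if "z \<in> {0..R}" for z
        using that by (intro DERIV_subset[OF d]) auto
      show "norm (\<psi>' z) \<le> P" if "z \<in> {0..R}" for z
        using Q'[OF that] P by simp
    qed (use that in auto)
    then show ?thesis by simp
  qed
  have line: "a + s * (b - a) \<in> {0..R}" if "s \<in> {0..1}" "a \<in> {0..R}" "b \<in> {0..R}" for s a b :: real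
  proof -
    have "a + s * (b - a) = (1 - s) * a + s * b" by (simp add: algebra_simps)
    moreover have "(1 - s) * a + s * b \<le> R" using that
      by (intro convex_bound_le) auto
    ultimately show ?thesis using that by simp
  qed
  have "\<bar>integral_mean \<psi> a b\<bar> \<le> P \<and>
    \<bar>integral_mean \<psi> a b - integral_mean \<psi> a' b'\<bar> \<le> P * (\<bar>a - a'\<bar> + \<bar>b - b'\<bar>)"
    if "a \<in> {0..R}" "b \<in> {0..R}" "a' \<in> {0..R}" "b' \<in> {0..R}" for a b a' b'
  proof
    note I = integral_mean_eq_integral[OF cont, of a b] and I' = integral_mean_eq_integral[OF cont, of a' b']
    show "\<bar>integral_mean \<psi> a b\<bar> \<le> P"
    proof -
      have "norm (integral_mean \<psi> a b) \<le> P * measure lborel {0..1::real}"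
      proof (rule has_integral_bound_real[OF _ _ I])
        show "norm (\<psi> (a + s * (b - a))) \<le> P" if "s \<in> {0..1} - {}" for s
          using Q[OF line, of s a b] that \<open>a \<in> {0..R}\<close> \<open>b \<in> {0..R}\<close> P by simp
      qed (use that P in auto)
      then show ?thesis by simp
    qed
    have "norm (integral_mean \<psi> a b - integral_mean \<psi> a' b') \<le> P * (\<bar>a - a'\<bar> + \<bar>b - b'\<bar>) * measure lborel {0..1::real}"
    proof (rule has_integral_bound_real)
      show "((\<lambda>s. \<psi> (a + s * (b - a)) - \<psi> (a' + s * (b' - a'))) has_integral
        (integral_mean \<psi> a b - integral_mean \<psi> a' b')) {0..1}"
        using that by (intro has_integral_diff I I') auto
      fix s :: real assume "s \<in> {0..1} - {}"
      then have s: "s \<in> {0..1}" by simp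
      have "\<bar>\<psi> (a + s * (b - a)) - \<psi> (a' + s * (b' - a'))\<bar> \<le> P * \<bar>(a + s * (b - a)) - (a' + s * (b' - a'))\<bar>"
        using s that by (intro lip line) auto
      also have "(a + s * (b - a)) - (a' + s * (b' - a')) = (1 - s) * (a - a') + s * (b - b')"
        by (simp add: algebra_simps)
      also have "\<bar>(1 - s) * (a - a') + s * (b - b')\<bar> \<le> (1 - s) * \<bar>a - a'\<bar> + s * \<bar>b - b'\<bar>"
        using s by (intro order_trans[OF abs_triangle_ineq]) (simp add: abs_mult)
      also have "\<dots> \<le> 1 * \<bar>a - a'\<bar> + 1 * \<bar>b - b'\<bar>"
        using s by (intro add_mono mult_right_mono) auto
      finally show "norm (\<psi> (a + s * (b - a)) - \<psi> (a' + s * (b' - a'))) \<le> P * (\<bar>a - a'\<bar> + \<bar>b - b'\<bar>)"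
        using P by simp
    qed (use P in auto)
    then show "\<bar>integral_mean \<psi> a b - integral_mean \<psi> a' b'\<bar> \<le> P * (\<bar>a - a'\<bar> + \<bar>b - b'\<bar>)" by simp
  qed
  then show ?thesis using P by blast
qed

lemma C2_on_imp_C1:
  assumes "C2_on {0..} \<psi>"
  obtains \<psi>' where "\<And>s. 0 \<le> s \<Longrightarrow> (\<psi> has_real_derivative \<psi>' s) (at s within {0..})" "continuous_on {0..} \<psi>'"
proof -
  obtain \<psi>' \<psi>'' where "\<forall>s\<in>{0..}. (\<psi> has_real_derivative \<psi>' s) (at s within {0..})"
     "\<forall>s\<in>{0..}. (\<psi>' has_real_derivative \<psi>'' s) (at s within {0..})"
    using assms unfolding C2_on_def by blast
  then show ?thesis using that[of \<psi>'] by (auto intro: DERIV_continuous_on)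
qed

section \<open>Discrete energy inequalities\<close>

text \<open>The unknown \<open>e k\<close> also stands on the right, so it must be absorbed:
  \<open>c * \<tau> \<le> 1 / 2\<close> keeps its coefficient on the left at least one half. This
  accounts for the factor \<open>2\<close> at \<open>\<phi>\<close>.\<close>

lemma discrete_gronwall:
  fixes e \<phi> :: "nat \<Rightarrow> real"
  assumes c: "0 \<le> c" "0 \<le> \<tau>" "c * \<tau> \<le> 1 / 2"
    and e: "\<And>k. k \<le> m \<Longrightarrow> 0 \<le> e k" and \<phi>: "\<And>k. 0 \<le> \<phi> k"
    and step: "\<And>k. k \<in> {1..m} \<Longrightarrow> e k - e (k - 1) \<le> \<tau> * \<phi> k + c * \<tau> * (e k + e (k - 1))"
  shows "k \<le> m \<Longrightarrow> e k \<le> exp (4 * c * \<tau> * k) * (e 0 + 2 * \<tau> * (\<Sum>i=1..k. \<phi> i))"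
proof (induction k)
  case (Suc k)
  define x where "x = c * \<tau>"
  have x: "0 \<le> x" "x \<le> 1 / 2" using c by (auto simp: x_def)
  have "(1 - x) * e (Suc k) \<le> (1 + x) * e k + \<tau> * \<phi> (Suc k)"
    using step[of "Suc k"] Suc.prems by (simp add: x_def algebra_simps)
  also have "\<dots> \<le> ((1 - x) * exp (4 * x)) * e k + (1 - x) * (2 * (\<tau> * \<phi> (Suc k)))"
  proof (intro add_mono mult_right_mono)
    show "0 \<le> e k" using Suc.prems by (intro e) simp
    \<comment> \<open>For \<open>x\<close> in \<open>{0..1/2}\<close> this gives
      \<open>(1 + x) / (1 - x) \<le> 1 + 4 * x\<close>, the origin of the \<open>4\<close> in the
      exponent.\<close>
    have "4 * x\<^sup>2 \<le> 2 * x" using mult_left_mono[OF x(2), of "4 * x"] x by (simp add: power2_eq_square)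
    then have "1 + x \<le> (1 - x) * (1 + 4 * x)" by (simp add: algebra_simps power2_eq_square)
    also have "\<dots> \<le> (1 - x) * exp (4 * x)" using x by (intro mult_left_mono) auto
    finally show "1 + x \<le> (1 - x) * exp (4 * x)" .
    have "1 * (\<tau> * \<phi> (Suc k)) \<le> (2 * (1 - x)) * (\<tau> * \<phi> (Suc k))"
      using x c \<phi> by (intro mult_right_mono) auto
    then show "\<tau> * \<phi> (Suc k) \<le> (1 - x) * (2 * (\<tau> * \<phi> (Suc k)))" by (simp add: algebra_simps)
  qed
  also have "\<dots> = (1 - x) * (exp (4 * x) * e k + 2 * \<tau> * \<phi> (Suc k))" by (simp add: algebra_simps)
  finally have "e (Suc k) \<le> exp (4 * x) * e k + 2 * \<tau> * \<phi> (Suc k)" using x by simp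
  also have "\<dots> \<le> exp (4 * x) * (exp (4 * x * k) * (e 0 + 2 * \<tau> * (\<Sum>i=1..k. \<phi> i)))
      + exp (4 * x * Suc k) * (2 * \<tau> * \<phi> (Suc k))"
  proof (intro add_mono mult_left_mono)
    show "e k \<le> exp (4 * x * k) * (e 0 + 2 * \<tau> * (\<Sum>i=1..k. \<phi> i))"
      using Suc by (simp add: x_def mult.assoc)
    have "1 \<le> exp (4 * x * Suc k)" using x by simp
    then show "2 * \<tau> * \<phi> (Suc k) \<le> exp (4 * x * Suc k) * (2 * \<tau> * \<phi> (Suc k))"
      using c \<phi>[of "Suc k"] mult_right_mono[of 1 "exp (4 * x * Suc k)" "2 * \<tau> * \<phi> (Suc k)"] by simp
  qed auto
  also have "\<dots> = exp (4 * x * Suc k) * (e 0 + 2 * \<tau> * (\<Sum>i=1..Suc k. \<phi> i))"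
    by (simp add: exp_add[symmetric] algebra_simps)
  finally show ?case by (simp add: x_def mult.assoc)
qed simp

text \<open>\<open>W0\<close> and \<open>W1\<close> stand for arbitrary potential energies and
  \<open>r\<close> for forces whose work is at least their increment. The increment of the energy is
  at most \<open>\<tau> * norm g\<close> times the sum of the two square roots; dividing by that sum
  leaves a bound linear in \<open>norm g\<close>.\<close>

lemma energy_step:
  fixes B :: "'a::real_inner \<Rightarrow> 'a"
  assumes lin: "linear_operator D B"
    and sym: "\<And>x y. x \<in> D \<Longrightarrow> y \<in> D \<Longrightarrow> inner (B x) y = inner x (B y)"
    and nonneg: "\<And>x. x \<in> D \<Longrightarrow> 0 \<le> inner (B x) x"
    and D: "x \<in> D" "y \<in> D" "w \<in> D" and \<tau>: "0 < \<tau>" and a: "0 \<le> a1" "0 \<le> a2" and W: "0 \<le> W0" "0 \<le> W1"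
    and eq: "(w - 2 *\<^sub>R y + x) /\<^sub>R \<tau>\<^sup>2 + a1 *\<^sub>R B ((w - x) /\<^sub>R (2 * \<tau>)) + a2 *\<^sub>R B ((w + x) /\<^sub>R 2) + r = g"
    and work: "W1 - W0 \<le> inner r (w - x)"
  shows "sqrt ((norm ((w - y) /\<^sub>R \<tau>))\<^sup>2 + a2 / 2 * (inner (B w) w + inner (B y) y) + W1)
    - sqrt ((norm ((y - x) /\<^sub>R \<tau>))\<^sup>2 + a2 / 2 * (inner (B y) y + inner (B x) x) + W0) \<le> \<tau> * norm g"
proof -
  note ls = linear_operator_simps[OF lin]
  define p q where "p = norm ((w - y) /\<^sub>R \<tau>)" and "q = norm ((y - x) /\<^sub>R \<tau>)"
  define E1 where "E1 = p\<^sup>2 + a2 / 2 * (inner (B w) w + inner (B y) y) + W1"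
  define E0 where "E0 = q\<^sup>2 + a2 / 2 * (inner (B y) y + inner (B x) x) + W0"
  have E: "p\<^sup>2 \<le> E1" "q\<^sup>2 \<le> E0" unfolding E1_def E0_def using nonneg D a W by simp_all
  have pq: "0 \<le> p" "0 \<le> q" by (auto simp: p_def q_def)
  have sE: "p \<le> sqrt E1" "q \<le> sqrt E0" using E pq by (auto intro: real_le_rsqrt)
  \<comment> \<open>With the increments \<open>w - y\<close> and \<open>y - x\<close>, the second
    difference is their difference and the test vector is their sum.\<close>
  have inertia: "inner ((w - 2 *\<^sub>R y + x) /\<^sub>R \<tau>\<^sup>2) (w - x) = p\<^sup>2 - q\<^sup>2"
  proof -
    have "p\<^sup>2 - q\<^sup>2 = (inner (w - y) (w - y) - inner (y - x) (y - x)) / \<tau>\<^sup>2"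
      using \<tau> by (simp add: p_def q_def power_mult_distrib power2_norm_eq_inner power_inverse left_diff_distrib divide_inverse)
    also have "inner (w - y) (w - y) - inner (y - x) (y - x) = inner (w - 2 *\<^sub>R y + x) (w - x)"
      by (simp add: inner_simps inner_commute)
    finally show ?thesis by (simp add: divide_inverse)
  qed
  have damping: "0 \<le> inner (B ((w - x) /\<^sub>R (2 * \<tau>))) (w - x)"
    using nonneg[OF ls(2)[OF D(3,1)]] D \<tau> ls by simp
  \<comment> \<open>Symmetry cancels the mixed products. The middle layer occurs in both energies,
    so the remaining terms at \<open>w\<close> and \<open>x\<close> form an energy
    increment.\<close>
  have stiffness: "inner (B ((w + x) /\<^sub>R 2)) (w - x) = (inner (B w) w - inner (B x) x) / 2"
    using D ls sym[OF D(3,1)] by (simp add: inner_simps inner_commute)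
  have "inner g (w - x) = (p\<^sup>2 - q\<^sup>2) + a1 * inner (B ((w - x) /\<^sub>R (2 * \<tau>))) (w - x)
      + a2 * ((inner (B w) w - inner (B x) x) / 2) + inner r (w - x)"
    unfolding eq[symmetric] inner_add_left inertia stiffness[symmetric] by simp
  then have "E1 - E0 \<le> inner g (w - x)"
    using mult_nonneg_nonneg[OF a(1) damping] work by (simp add: E1_def E0_def field_simps)
  also have "\<dots> \<le> norm g * norm ((w - y) + (y - x))" using norm_cauchy_schwarz[of g "w - x"] by simp
  also have "\<dots> \<le> norm g * (norm (w - y) + norm (y - x))"
    by (intro mult_left_mono norm_triangle_ineq) auto
  also have "\<dots> = \<tau> * norm g * (p + q)" using \<tau> unfolding p_def q_def norm_scaleR by (simp add: field_simps)
  also have "\<dots> \<le> \<tau> * norm g * (sqrt E1 + sqrt E0)" using sE \<tau> by (intro mult_left_mono add_mono) auto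
  finally have "E1 - E0 \<le> \<tau> * norm g * (sqrt E1 + sqrt E0)" .
  moreover have "E1 - E0 = (sqrt E1 - sqrt E0) * (sqrt E1 + sqrt E0)"
    using E by (simp add: algebra_simps) (smt (verit) real_sqrt_mult_self zero_le_power2)
  ultimately have *: "(sqrt E1 - sqrt E0) * (sqrt E1 + sqrt E0) \<le> \<tau> * norm g * (sqrt E1 + sqrt E0)" by simp
  \<comment> \<open>The common factor can be cancelled only if it is positive; if it is zero, both
    energies vanish.\<close>
  have "sqrt E1 - sqrt E0 \<le> \<tau> * norm g"
  proof (cases "sqrt E1 + sqrt E0 = 0")
    case True
    then have "sqrt E1 - sqrt E0 \<le> 0" using sE pq by linarith
    also have "0 \<le> \<tau> * norm g" using \<tau> by simp
    finally show ?thesis .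
  next
    case False
    then have "0 < sqrt E1 + sqrt E0" using sE pq by linarith
    then show ?thesis using * by (rule mult_right_le_imp_le[rotated])
  qed
  then show ?thesis by (simp add: E1_def E0_def p_def q_def)
qed

section \<open>Elementary inequalities for products, initial energies and small steps\<close>

text \<open>A product rule for Lipschitz constants, with \<open>\<zeta>\<close> as the common
  measure of distance. The shape \<open>X * Y + Z * W\<close> recurs in the constants of
  \<open>lower_terms_Lipschitz\<close>.\<close>

lemma norm_scaleR_diff_le:
  fixes a b :: "'a::real_normed_vector"
  assumes "\<bar>x\<bar> \<le> X" "norm (a - b) \<le> Y * \<zeta>" "\<bar>x - y\<bar> \<le> Z * \<zeta>" "norm b \<le> W"
  shows "norm (x *\<^sub>R a - y *\<^sub>R b) \<le> (X * Y + Z * W) * \<zeta>"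
proof -
  have "x *\<^sub>R a - y *\<^sub>R b = x *\<^sub>R (a - b) + (x - y) *\<^sub>R b" by (simp add: algebra_simps)
  then have "norm (x *\<^sub>R a - y *\<^sub>R b) \<le> \<bar>x\<bar> * norm (a - b) + \<bar>x - y\<bar> * norm b"
    by (metis norm_scaleR norm_triangle_ineq)
  also have "\<dots> \<le> X * (Y * \<zeta>) + (Z * \<zeta>) * W"
    using assms by (intro add_mono mult_mono') auto
  finally show ?thesis by (simp add: algebra_simps)
qed

lemma inner_diff_le:
  fixes a a' b b' :: "'a::real_inner"
  assumes "norm a \<le> X" "norm (b - b') \<le> Y * \<zeta>" "norm (a - a') \<le> Z * \<zeta>" "norm b' \<le> W"
  shows "\<bar>inner a b - inner a' b'\<bar> \<le> (X * Y + Z * W) * \<zeta>"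
proof -
  have "inner a b - inner a' b' = inner a (b - b') + inner (a - a') b'" by (simp add: inner_simps)
  then have "\<bar>inner a b - inner a' b'\<bar> \<le> norm a * norm (b - b') + norm (a - a') * norm b'"
    using Cauchy_Schwarz_ineq2[of a "b - b'"] Cauchy_Schwarz_ineq2[of "a - a'" b'] by linarith
  also have "\<dots> \<le> X * (Y * \<zeta>) + (Z * \<zeta>) * W"
    using assms by (intro add_mono mult_mono') auto
  finally show ?thesis by (simp add: algebra_simps)
qed

lemma sqrt_sum_squares_le:
  assumes "0 \<le> p" "0 \<le> a" "0 \<le> x" "0 \<le> y"
  shows "sqrt (p\<^sup>2 + a * (x\<^sup>2 + y\<^sup>2)) \<le> p + sqrt a * (x + y)"
proof (rule real_le_lsqrt)
  have "0 \<le> 2 * p * (sqrt a * (x + y)) + a * (2 * x * y)" using assms by simp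
  moreover have "(sqrt a * (x + y))\<^sup>2 = a * (x + y)\<^sup>2" using assms by (simp add: power_mult_distrib)
  ultimately show "p\<^sup>2 + a * (x\<^sup>2 + y\<^sup>2) \<le> (p + sqrt a * (x + y))\<^sup>2"
    by (simp add: power2_sum algebra_simps)
  show "0 \<le> p + sqrt a * (x + y)" using assms by simp
qed

lemma mono_on_diff_mult_nonneg:
  fixes \<psi> :: "real \<Rightarrow> real"
  assumes "mono_on S \<psi>" "a \<in> S" "b \<in> S"
  shows "0 \<le> (\<psi> b - \<psi> a) * (b - a)"
proof (cases "a \<le> b")
  case True
  then show ?thesis using mono_onD[OF assms] by simp
next
  case False
  then show ?thesis using mono_onD[OF assms(1,3,2)] by (intro mult_nonpos_nonpos) auto
qed

lemma ex_nat_step_small: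
  fixes q T :: real
  assumes "0 \<le> q"
  shows "\<exists>n0. \<forall>n\<ge>n0. 1 < n \<longrightarrow> q * (T / real n) \<le> 1 / 2"
proof -
  obtain n0 where n0: "2 * q * T \<le> real n0" using real_arch_simple by blast
  have "q * (T / real n) \<le> 1 / 2" if "n0 \<le> n" "1 < n" for n
  proof -
    have "2 * (q * T) \<le> real n" using n0 that(1) by simp
    then show ?thesis using that(2) by (simp add: field_simps)
  qed
  then show ?thesis by blast
qed

section \<open>The nonlinear scheme\<close>

locale nonlinear_scheme =
  fixes A B C N M :: "'a::{real_inner, banach} \<Rightarrow> 'a"
    and DA DB DC :: "'a set"
    and \<psi>1 \<psi>2 \<psi>3 :: "real \<Rightarrow> real"
    and a0 a1 a2 b0 :: real
  assumes sa_A: "self_adjoint DA A" and pd_A: "positively_defined DA A"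
    and sa_B: "self_adjoint DB B" and pd_B: "positively_defined DB B"
    and DB_DA: "DB \<subseteq> DA"
    and b0: "b0 > 0" and A_B: "\<And>v. v \<in> DB \<Longrightarrow> (norm (A v))\<^sup>2 \<le> b0\<^sup>2 * inner (B v) v"
    and \<psi>1: "C2_on {0..} \<psi>1" "\<And>s. s \<ge> 0 \<Longrightarrow> \<psi>1 s \<ge> 0"
    and \<psi>2: "C2_on {0..} \<psi>2" "mono_on {0..} \<psi>2"
    and \<psi>3: "C2_on {0..} \<psi>3" "\<And>s. s \<ge> 0 \<Longrightarrow> \<psi>3 s \<ge> 0"
    and lin_C: "linear_operator DC C" and DA_DC: "DA \<subseteq> DC"
    and a0: "a0 > 0" and C_A: "\<And>v. v \<in> DA \<Longrightarrow> norm (C v) \<le> a0 * norm (A v)"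
    and bl_N: "bounded_linear N"
    and lip_M: "\<exists>L. L-lipschitz_on UNIV M"
    and a1: "a1 > 0" and a2: "a2 > 0"
begin

abbreviation energy_norm :: "'a \<Rightarrow> real" (\<open>\<lblot>_\<rblot>\<close>) where
  "\<lblot>v\<rblot> \<equiv> norm (sqrt_operator DB B v)"

abbreviation \<gamma> where "\<gamma> \<equiv> gamma_coeff DA A"

abbreviation velocity :: "real \<Rightarrow> (nat \<Rightarrow> 'a) \<Rightarrow> nat \<Rightarrow> 'a" where
  "velocity \<tau> v k \<equiv> (v (k + 1) - v k) /\<^sub>R \<tau>"

lemma lin_A: "linear_operator DA A" and lin_B: "linear_operator DB B"
  using sa_A sa_B unfolding self_adjoint_def by auto

lemma DB_imp_DA: "v \<in> DB \<Longrightarrow> v \<in> DA"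
  using DB_DA by blast

lemmas DB_closed = linear_operator_simps(1-3)[OF lin_B]

lemma A_linear:
  "x \<in> DB \<Longrightarrow> y \<in> DB \<Longrightarrow> A (x + y) = A x + A y" "x \<in> DB \<Longrightarrow> A (r *\<^sub>R x) = r *\<^sub>R A x"
  "x \<in> DB \<Longrightarrow> y \<in> DB \<Longrightarrow> A (x - y) = A x - A y"
  using linear_operator_simps(5-7)[OF lin_A] DB_imp_DA by auto

lemma C_diff: "x \<in> DB \<Longrightarrow> y \<in> DB \<Longrightarrow> C (x - y) = C x - C y"
  using linear_operator_simps(7)[OF lin_C] DB_imp_DA DA_DC by blast

lemma energy_norm_power2: "v \<in> DB \<Longrightarrow> \<lblot>v\<rblot>\<^sup>2 = inner (B v) v"
  by (rule norm_sqrt_operator[OF sa_B pd_B])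

lemma energy_norm_linear:
  "x \<in> DB \<Longrightarrow> y \<in> DB \<Longrightarrow> \<lblot>x + y\<rblot> \<le> \<lblot>x\<rblot> + \<lblot>y\<rblot>" "x \<in> DB \<Longrightarrow> \<lblot>r *\<^sub>R x\<rblot> = \<bar>r\<bar> * \<lblot>x\<rblot>"
  using linear_operator_simps[OF sqrt_operator_linear[OF sa_B pd_B]]
  by (simp_all add: norm_triangle_ineq)

lemma gamma_eq: "v k \<in> DB \<Longrightarrow> \<gamma> v k = inner (A (v k)) (v k)"
  unfolding gamma_coeff_def using norm_sqrt_operator[OF sa_A pd_A] DB_DA by blast

lemma gamma_nonneg: "0 \<le> \<gamma> v k"
  by (simp add: gamma_coeff_def)

lemma norm_A_le:
  assumes "v \<in> DB"
  shows "norm (A v) \<le> b0 * \<lblot>v\<rblot>"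
proof (rule power2_le_imp_le)
  show "(norm (A v))\<^sup>2 \<le> (b0 * \<lblot>v\<rblot>)\<^sup>2"
    unfolding power_mult_distrib energy_norm_power2[OF assms] by (rule A_B[OF assms])
qed (use b0 in simp)

lemma norm_C_le: "v \<in> DB \<Longrightarrow> norm (C v) \<le> a0 * b0 * \<lblot>v\<rblot>"
  using order_trans[OF C_A[OF DB_imp_DA] mult_left_mono[OF norm_A_le]] a0 by (simp add: mult.assoc)

lemma norm_le_energy_norm: "\<exists>\<beta>>0. \<forall>v\<in>DB. norm v \<le> \<beta> * \<lblot>v\<rblot>"
proof -
  obtain m where m: "m > 0" "\<And>u. u \<in> DB \<Longrightarrow> m * (norm u)\<^sup>2 \<le> inner (B u) u"
    using pd_B unfolding positively_defined_def by blast
  have "norm v \<le> 1 / sqrt m * \<lblot>v\<rblot>" if "v \<in> DB" for v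
  proof (rule power2_le_imp_le)
    show "(norm v)\<^sup>2 \<le> (1 / sqrt m * \<lblot>v\<rblot>)\<^sup>2"
      using m(2)[OF that] m(1) unfolding power_mult_distrib energy_norm_power2[OF that]
      by (simp add: power_divide field_simps)
  qed (use m in auto)
  then show ?thesis using m(1) by (intro exI[of _ "1 / sqrt m"]) auto
qed

lemma M_Lipschitz: "\<exists>L>0. \<forall>x y. norm (M x - M y) \<le> L * norm (x - y)"
proof -
  obtain L where "L-lipschitz_on UNIV M" using lip_M by blast
  then have "norm (M x - M y) \<le> L * norm (x - y)" for x y
    unfolding lipschitz_on_def dist_norm by blast
  moreover have "L * norm (x - y) \<le> max 1 L * norm (x - y)" for x y :: 'a
    by (intro mult_right_mono) auto
  ultimately have "norm (M x - M y) \<le> max 1 L * norm (x - y)" for x y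
    using order_trans by blast
  then show ?thesis by (intro exI[of _ "max 1 L"]) auto
qed

text \<open>The mixed products cancel by symmetry of \<open>A\<close>. This serves twice: for the
  work of the terms with \<open>A\<close>, and for removing the division by \<open>\<tau>\<close>
  from \<open>d_coeff\<close>.\<close>

lemma gamma_diff:
  assumes "x \<in> DB" "w \<in> DB"
  shows "inner (A ((w + x) /\<^sub>R 2)) (w - x) = (inner (A w) w - inner (A x) x) / 2"
proof -
  have "A ((w + x) /\<^sub>R 2) = (A w + A x) /\<^sub>R 2"
    using A_linear(2)[OF DB_closed(1)[OF assms(2,1)]] A_linear(1)[OF assms(2,1)] by simp
  moreover have "inner (A w) x = inner (A x) w"
    using self_adjoint_symmetric[OF sa_A DB_imp_DA DB_imp_DA, OF assms(2,1)] by (simp add: inner_commute)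
  ultimately show ?thesis by (simp add: inner_simps field_simps)
qed

text \<open>The constant \<open>\<kappa>\<close> comes from bounding each of the five terms by one of the energies of
  two consecutive layers.\<close>

lemma energy_estimate:
  fixes v :: "nat \<Rightarrow> 'a" and W \<phi> :: "nat \<Rightarrow> real" and c \<tau> T :: real
  defines "\<kappa> \<equiv> 2 * sqrt (2 / a2) + 1"
  defines "E0 \<equiv> (norm (velocity \<tau> v 0))\<^sup>2 + a2 / 2 * (\<lblot>v 1\<rblot>\<^sup>2 + \<lblot>v 0\<rblot>\<^sup>2) + W 0"
  assumes \<tau>: "0 < \<tau>" and c: "0 \<le> c" "c * \<kappa> * \<tau> \<le> 1 / 2" and T: "real n * \<tau> \<le> T"
    and v: "\<And>k. k \<le> n \<Longrightarrow> v k \<in> DB" and W: "\<And>k. k < n \<Longrightarrow> 0 \<le> W k" and \<phi>: "\<And>k. 0 \<le> \<phi> k"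
    and eq: "\<And>k. k \<in> {1..n - 1} \<Longrightarrow> (v (k + 1) - 2 *\<^sub>R v k + v (k - 1)) /\<^sub>R \<tau>\<^sup>2
      + a1 *\<^sub>R B ((v (k + 1) - v (k - 1)) /\<^sub>R (2 * \<tau>))
      + a2 *\<^sub>R B ((v (k + 1) + v (k - 1)) /\<^sub>R 2) + r k = g k"
    and work: "\<And>k. k \<in> {1..n - 1} \<Longrightarrow> W k - W (k - 1) \<le> inner (r k) (v (k + 1) - v (k - 1))"
    and g: "\<And>k. k \<in> {1..n - 1} \<Longrightarrow> norm (g k) \<le> \<phi> k + c * (\<lblot>v (k + 1)\<rblot> + \<lblot>v k\<rblot> + \<lblot>v (k - 1)\<rblot>
      + norm (velocity \<tau> v k) + norm (velocity \<tau> v (k - 1)))"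
    and k: "k < n"
  shows "\<lblot>v (k + 1)\<rblot> + \<lblot>v k\<rblot> + norm (velocity \<tau> v k)
    \<le> \<kappa> * exp (4 * c * \<kappa> * T) * (sqrt E0 + 2 * \<tau> * (\<Sum>i=1..k. \<phi> i))"
proof -
  \<comment> \<open>\<open>\<sigma>\<close> is the factor by which the square root of the energy
    controls a single energy norm, whose square is weighted with \<open>a2 / 2\<close>.\<close>
  define \<sigma> where "\<sigma> = sqrt (2 / a2)"
  have \<sigma>: "0 \<le> \<sigma>" "\<kappa> = 2 * \<sigma> + 1" "\<sigma>\<^sup>2 * (a2 / 2) = 1" using a2 by (auto simp: \<sigma>_def \<kappa>_def)
  define E where "E k = (norm (velocity \<tau> v k))\<^sup>2 + a2 / 2 * (\<lblot>v (k + 1)\<rblot>\<^sup>2 + \<lblot>v k\<rblot>\<^sup>2) + W k" for k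
  define e where "e k = sqrt (E k)" for k
  have E_nonneg: "0 \<le> E k" if "k < n" for k
    unfolding E_def using that W a2 by (simp add: add_nonneg_nonneg)
  have e_nonneg: "0 \<le> e k" if "k < n" for k unfolding e_def using E_nonneg[OF that] by simp
  have le_e: "norm (velocity \<tau> v k) \<le> e k" "\<lblot>v (k + 1)\<rblot> \<le> \<sigma> * e k" "\<lblot>v k\<rblot> \<le> \<sigma> * e k" if "k < n" for k
  proof -
    have *: "(norm (velocity \<tau> v k))\<^sup>2 \<le> E k" "a2 / 2 * \<lblot>v (k + 1)\<rblot>\<^sup>2 \<le> E k" "a2 / 2 * \<lblot>v k\<rblot>\<^sup>2 \<le> E k"
      using W[OF that] a2 by (auto simp: E_def field_simps add_nonneg_nonneg)
    show "norm (velocity \<tau> v k) \<le> e k" unfolding e_def using *(1) by (rule real_le_rsqrt)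
    have **: "x \<le> \<sigma> * e k" if x: "0 \<le> x" "a2 / 2 * x\<^sup>2 \<le> E k" for x
    proof (rule power2_le_imp_le)
      have "x\<^sup>2 = \<sigma>\<^sup>2 * (a2 / 2 * x\<^sup>2)" using \<sigma>(3) by (metis mult.assoc mult_1)
      also have "\<dots> \<le> \<sigma>\<^sup>2 * E k" using x by (intro mult_left_mono) auto
      finally show "x\<^sup>2 \<le> (\<sigma> * e k)\<^sup>2" using E_nonneg[OF \<open>k < n\<close>] by (simp add: power_mult_distrib e_def)
    qed (use \<sigma> e_nonneg[OF \<open>k < n\<close>] in auto)
    show "\<lblot>v (k + 1)\<rblot> \<le> \<sigma> * e k" "\<lblot>v k\<rblot> \<le> \<sigma> * e k" using *(2,3) by (auto intro: **)
  qed
  have step: "e k - e (k - 1) \<le> \<tau> * \<phi> k + (c * \<kappa>) * \<tau> * (e k + e (k - 1))" if k: "k \<in> {1..n - 1}" for k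
  proof -
    have kn: "k < n" "k - 1 < n" "k - 1 + 1 = k" using k by auto
    have "e k - e (k - 1) \<le> \<tau> * norm (g k)"
    proof -
      have "sqrt ((norm ((v (k + 1) - v k) /\<^sub>R \<tau>))\<^sup>2
          + a2 / 2 * (inner (B (v (k + 1))) (v (k + 1)) + inner (B (v k)) (v k)) + W k)
        - sqrt ((norm ((v k - v (k - 1)) /\<^sub>R \<tau>))\<^sup>2
          + a2 / 2 * (inner (B (v k)) (v k) + inner (B (v (k - 1))) (v (k - 1))) + W (k - 1)) \<le> \<tau> * norm (g k)"
      proof (rule energy_step[OF lin_B, where ?a1.0 = a1 and r = "r k"])
        show "inner (B x) y = inner x (B y)" if "x \<in> DB" "y \<in> DB" for x y
          using self_adjoint_symmetric[OF sa_B] that by blast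
        show "0 \<le> inner (B x) x" if "x \<in> DB" for x
          using energy_norm_power2[OF that] by (metis zero_le_power2)
        show "v (k - 1) \<in> DB" "v k \<in> DB" "v (k + 1) \<in> DB" using k by (auto intro: v)
        show "0 \<le> W (k - 1)" "0 \<le> W k" using kn by (auto intro: W)
        show "0 \<le> a1" "0 \<le> a2" using a1 a2 by auto
      qed (rule \<tau> eq[OF k] work[OF k])+
      moreover have "inner (B (v (k + 1))) (v (k + 1)) = \<lblot>v (k + 1)\<rblot>\<^sup>2"
        "inner (B (v k)) (v k) = \<lblot>v k\<rblot>\<^sup>2" "inner (B (v (k - 1))) (v (k - 1)) = \<lblot>v (k - 1)\<rblot>\<^sup>2"
        by (rule energy_norm_power2[OF v, symmetric], use k in force)+
      ultimately show ?thesis by (simp only: e_def E_def kn(3))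
    qed
    also have "\<dots> \<le> \<tau> * (\<phi> k + c * (\<kappa> * (e k + e (k - 1))))"
    proof -
      have "\<lblot>v (k + 1)\<rblot> + \<lblot>v k\<rblot> + \<lblot>v (k - 1)\<rblot> + norm (velocity \<tau> v k) + norm (velocity \<tau> v (k - 1))
        \<le> \<sigma> * e k + \<sigma> * e k + \<sigma> * e (k - 1) + e k + e (k - 1)"
        using le_e[OF kn(1)] le_e[OF kn(2)] by linarith
      \<comment> \<open>The older layer contributes only one energy norm; adding the missing
        \<open>\<sigma> * e (k - 1)\<close> makes the bound symmetric, with
        \<open>\<kappa> = 2 * \<sigma> + 1\<close>.\<close>
      also have "\<dots> \<le> \<kappa> * (e k + e (k - 1))"
        using mult_nonneg_nonneg[OF \<sigma>(1) e_nonneg[OF kn(2)]] by (simp add: \<sigma>(2) algebra_simps)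
      finally have "norm (g k) \<le> \<phi> k + c * (\<kappa> * (e k + e (k - 1)))"
        by (intro order_trans[OF g[OF k]] add_left_mono mult_left_mono[OF _ c(1)])
      then show ?thesis using \<tau> by (intro mult_left_mono) auto
    qed
    finally show ?thesis by (simp add: algebra_simps)
  qed
  \<comment> \<open>\<open>e k\<close> involves \<open>v (k + 1)\<close>, so \<open>n - 1\<close> is
    the last admissible index.\<close>
  have "e k \<le> exp (4 * (c * \<kappa>) * \<tau> * k) * (e 0 + 2 * \<tau> * (\<Sum>i=1..k. \<phi> i))"
  proof (rule discrete_gronwall[where m = "n - 1"])
    show "0 \<le> c * \<kappa>" using c \<sigma> by simp
    show "0 \<le> e i" if "i \<le> n - 1" for i using e_nonneg that k by simp
    show "0 \<le> \<tau>" "k \<le> n - 1" using \<tau> k by auto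
  qed (fact c(2) \<phi> step)+
  also have "\<dots> \<le> exp (4 * c * \<kappa> * T) * (e 0 + 2 * \<tau> * (\<Sum>i=1..k. \<phi> i))"
  proof (intro mult_right_mono)
    have "real k * \<tau> \<le> real n * \<tau>" using k \<tau> by (intro mult_right_mono) auto
    then have "\<tau> * k \<le> T" using T by (simp add: mult.commute)
    then have "(4 * c * \<kappa>) * (\<tau> * k) \<le> (4 * c * \<kappa>) * T" using c \<sigma> by (intro mult_left_mono) auto
    then show "exp (4 * (c * \<kappa>) * \<tau> * k) \<le> exp (4 * c * \<kappa> * T)" by (simp add: mult.assoc)
    show "0 \<le> e 0 + 2 * \<tau> * (\<Sum>i=1..k. \<phi> i)"
      using e_nonneg[of 0] k \<tau> \<phi> by (simp add: sum_nonneg)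
  qed
  finally have ek: "e k \<le> exp (4 * c * \<kappa> * T) * (e 0 + 2 * \<tau> * (\<Sum>i=1..k. \<phi> i))" .
  have "\<lblot>v (k + 1)\<rblot> + \<lblot>v k\<rblot> + norm (velocity \<tau> v k) \<le> \<kappa> * e k"
    using le_e[OF k] by (simp add: \<sigma>(2) algebra_simps)
  also have "\<dots> \<le> \<kappa> * (exp (4 * c * \<kappa> * T) * (e 0 + 2 * \<tau> * (\<Sum>i=1..k. \<phi> i)))"
    using \<sigma> by (intro mult_left_mono[OF ek]) auto
  finally show ?thesis unfolding e_def E_def E0_def mult.assoc by simp
qed

section \<open>Lipschitz dependence of the lower order terms on the solution\<close>

definition lower_terms :: "real \<Rightarrow> (nat \<Rightarrow> 'a) \<Rightarrow> nat \<Rightarrow> 'a" where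
  "lower_terms \<tau> v k =
     (a1_coeff \<psi>1 DA A v k + d_coeff \<psi>2 \<tau> DA A v k) *\<^sub>R A ((v (k + 1) + v (k - 1)) /\<^sub>R 2)
     + a3_coeff \<psi>3 v k *\<^sub>R ((v (k + 1) + v (k - 1)) /\<^sub>R 2)
     + C (v k) + N ((v (k + 1) - v (k - 1)) /\<^sub>R (2 * \<tau>)) + M (v k)"

lemma scheme_lhs_eq:
  "scheme_lhs \<psi>1 \<psi>2 \<psi>3 a1 a2 DA A B C N M \<tau> v k =
     (v (k + 1) - 2 *\<^sub>R v k + v (k - 1)) /\<^sub>R \<tau>\<^sup>2
     + a1 *\<^sub>R B ((v (k + 1) - v (k - 1)) /\<^sub>R (2 * \<tau>))
     + a2 *\<^sub>R B ((v (k + 1) + v (k - 1)) /\<^sub>R 2) + lower_terms \<tau> v k"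
  by (simp only: scheme_lhs_def lower_terms_def add.assoc)

text \<open>The central difference quotient is the mean of two consecutive velocities, so the energy
  controls it uniformly in \<open>\<tau>\<close>.\<close>

lemma central_difference:
  fixes v :: "nat \<Rightarrow> 'a"
  assumes "1 \<le> k"
  shows "norm ((v (k + 1) - v (k - 1)) /\<^sub>R (2 * \<tau>))
    \<le> (norm (velocity \<tau> v k) + norm (velocity \<tau> v (k - 1))) / 2"
proof -
  have "velocity \<tau> v k + velocity \<tau> v (k - 1) = (v (k + 1) - v (k - 1)) /\<^sub>R \<tau>"
    using assms by (simp flip: scaleR_right_distrib)
  then have "(v (k + 1) - v (k - 1)) /\<^sub>R (2 * \<tau>) = (velocity \<tau> v k + velocity \<tau> v (k - 1)) /\<^sub>R 2"
    by (simp only: scaleR_scaleR inverse_mult_distrib)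
  then have eq: "norm ((v (k + 1) - v (k - 1)) /\<^sub>R (2 * \<tau>)) = norm (velocity \<tau> v k + velocity \<tau> v (k - 1)) / 2"
    by (simp only: norm_scaleR) simp
  show ?thesis unfolding eq by (intro divide_right_mono norm_triangle_ineq) simp
qed

text \<open>All factors are bounded and Lipschitz on the set given by \<open>K\<close>, so the
  product rules apply. The point is that \<open>c\<close> is chosen before \<open>\<tau>\<close>,
  which requires the rewriting of \<open>d_coeff\<close> in \<open>d_eq\<close>.\<close>

lemma lower_terms_Lipschitz:
  assumes K: "0 < K"
  shows "\<exists>c>0. \<forall>v w k \<tau>. 1 \<le> k \<longrightarrow> 0 < \<tau> \<longrightarrow>
    (\<forall>j\<in>{k - 1, k, k + 1}. v j \<in> DB \<and> w j \<in> DB \<and> \<lblot>v j\<rblot> \<le> K \<and> \<lblot>w j\<rblot> \<le> K) \<longrightarrow>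
    (\<forall>j\<in>{k - 1, k}. norm (velocity \<tau> v j) \<le> K \<and> norm (velocity \<tau> w j) \<le> K) \<longrightarrow>
    norm (lower_terms \<tau> v k - lower_terms \<tau> w k)
      \<le> c * (\<lblot>v (k + 1) - w (k + 1)\<rblot> + \<lblot>v k - w k\<rblot> + \<lblot>v (k - 1) - w (k - 1)\<rblot>
        + norm (velocity \<tau> (\<lambda>k. v k - w k) k) + norm (velocity \<tau> (\<lambda>k. v k - w k) (k - 1)))"
proof -
  obtain \<beta> where \<beta>: "0 < \<beta>" "\<And>v. v \<in> DB \<Longrightarrow> norm v \<le> \<beta> * \<lblot>v\<rblot>" using norm_le_energy_norm by blast
  obtain L where L: "0 < L" "\<And>x y. norm (M x - M y) \<le> L * norm (x - y)" using M_Lipschitz by blast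
  obtain \<nu> where \<nu>: "0 < \<nu>" "\<And>x. norm (N x) \<le> norm x * \<nu>" using bounded_linear.pos_bounded[OF bl_N] by blast
  obtain \<psi>1' where \<psi>1': "\<And>s. 0 \<le> s \<Longrightarrow> (\<psi>1 has_real_derivative \<psi>1' s) (at s within {0..})"
    "continuous_on {0..} \<psi>1'" using C2_on_imp_C1[OF \<psi>1(1)] by blast
  obtain \<psi>2' \<psi>2'' where \<psi>2': "\<And>s. 0 \<le> s \<Longrightarrow> (\<psi>2 has_real_derivative \<psi>2' s) (at s within {0..})"
    "\<And>s. 0 \<le> s \<Longrightarrow> (\<psi>2' has_real_derivative \<psi>2'' s) (at s within {0..})"
    "continuous_on {0..} \<psi>2''"
    using \<psi>2(1) unfolding C2_on_def by auto
  have \<psi>2'_cont: "continuous_on {0..} \<psi>2'" using \<psi>2'(2) by (intro DERIV_continuous_on) auto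
  obtain \<psi>3' where \<psi>3': "\<And>s. 0 \<le> s \<Longrightarrow> (\<psi>3 has_real_derivative \<psi>3' s) (at s within {0..})"
    "continuous_on {0..} \<psi>3'" using C2_on_imp_C1[OF \<psi>3(1)] by blast
  \<comment> \<open>One interval for all arguments of the means: the first entry bounds
    \<open>\<gamma>\<close>, the second the squared norms.\<close>
  define R where "R = max (b0 * \<beta> * K\<^sup>2) (\<beta>\<^sup>2 * K\<^sup>2)"
  obtain P1 where P1: "P1 > 0" "\<And>a b. a \<in> {0..R} \<Longrightarrow> b \<in> {0..R} \<Longrightarrow> \<bar>integral_mean \<psi>1 a b\<bar> \<le> P1"
    "\<And>a b a' b'. a \<in> {0..R} \<Longrightarrow> b \<in> {0..R} \<Longrightarrow> a' \<in> {0..R} \<Longrightarrow> b' \<in> {0..R} \<Longrightarrow>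
      \<bar>integral_mean \<psi>1 a b - integral_mean \<psi>1 a' b'\<bar> \<le> P1 * (\<bar>a - a'\<bar> + \<bar>b - b'\<bar>)"
    using integral_mean_bounded_Lipschitz[OF \<psi>1', of R] by metis
  \<comment> \<open>The mean is taken of the derivative of \<open>\<psi>2\<close>, so its Lipschitz
    bound uses the second derivative.\<close>
  obtain P2 where P2: "P2 > 0" "\<And>a b. a \<in> {0..R} \<Longrightarrow> b \<in> {0..R} \<Longrightarrow> \<bar>integral_mean \<psi>2' a b\<bar> \<le> P2"
    "\<And>a b a' b'. a \<in> {0..R} \<Longrightarrow> b \<in> {0..R} \<Longrightarrow> a' \<in> {0..R} \<Longrightarrow> b' \<in> {0..R} \<Longrightarrow>
      \<bar>integral_mean \<psi>2' a b - integral_mean \<psi>2' a' b'\<bar> \<le> P2 * (\<bar>a - a'\<bar> + \<bar>b - b'\<bar>)"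
    using integral_mean_bounded_Lipschitz[OF \<psi>2'(2,3), of R] by metis
  obtain P3 where P3: "P3 > 0" "\<And>a b. a \<in> {0..R} \<Longrightarrow> b \<in> {0..R} \<Longrightarrow> \<bar>integral_mean \<psi>3 a b\<bar> \<le> P3"
    "\<And>a b a' b'. a \<in> {0..R} \<Longrightarrow> b \<in> {0..R} \<Longrightarrow> a' \<in> {0..R} \<Longrightarrow> b' \<in> {0..R} \<Longrightarrow>
      \<bar>integral_mean \<psi>3 a b - integral_mean \<psi>3 a' b'\<bar> \<le> P3 * (\<bar>a - a'\<bar> + \<bar>b - b'\<bar>)"
    using integral_mean_bounded_Lipschitz[OF \<psi>3', of R] by metis
  \<comment> \<open>Lipschitz constants from the product rules: \<open>cA\<close> for
    \<open>\<gamma>\<close>, \<open>cS\<close> for the squared norm, \<open>cD\<close> for the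
    products \<open>Dv\<close>, \<open>Dw\<close>, and \<open>cd\<close> for \<open>d_coeff\<close>.
    \<open>Q\<close> bounds the whole coefficient of \<open>A\<close>, and \<open>c\<close> adds up
    the five terms.\<close>
  define cA cS where "cA = b0 * K * \<beta> + b0 * (\<beta> * K)" and "cS = \<beta> * K * \<beta> + \<beta> * (\<beta> * K)"
  define cD where "cD = b0 * (2 * K) * 1 + b0 * K"
  define cd where "cd = P2 * cD + P2 * (2 * cA) * (b0 * (2 * K) * K)"
  define Q where "Q = P1 + P2 * (b0 * (2 * K) * K)"
  define c where "c = (Q * b0 + (P1 * (2 * cA) + cd) * (b0 * K)) + (P3 * \<beta> + P3 * (2 * cS) * (\<beta> * K))
    + a0 * b0 + \<nu> + L * \<beta>"
  note pos = K b0 a0 \<beta>(1) L(1) \<nu>(1) P1(1) P2(1) P3(1)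
  have "0 < cA" "0 < cS" "0 < cD" unfolding cA_def cS_def cD_def using pos by (simp_all add: add_pos_pos)
  moreover from this have "0 < cd" "0 < Q" unfolding cd_def Q_def using pos by (simp_all add: add_pos_pos)
  ultimately have "0 < c" unfolding c_def using pos by (simp add: add_pos_pos)
  moreover have "norm (lower_terms \<tau> v k - lower_terms \<tau> w k)
      \<le> c * (\<lblot>v (k + 1) - w (k + 1)\<rblot> + \<lblot>v k - w k\<rblot> + \<lblot>v (k - 1) - w (k - 1)\<rblot>
        + norm (velocity \<tau> (\<lambda>k. v k - w k) k) + norm (velocity \<tau> (\<lambda>k. v k - w k) (k - 1)))"
    (is "_ \<le> c * ?\<zeta>")
    if k: "1 \<le> k" and \<tau>: "0 < \<tau>"
      and v: "\<forall>j\<in>{k - 1, k, k + 1}. v j \<in> DB \<and> w j \<in> DB \<and> \<lblot>v j\<rblot> \<le> K \<and> \<lblot>w j\<rblot> \<le> K"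
      and vel: "\<forall>j\<in>{k - 1, k}. norm (velocity \<tau> v j) \<le> K \<and> norm (velocity \<tau> w j) \<le> K"
    for v w :: "nat \<Rightarrow> 'a" and k \<tau>
  proof -
    define \<zeta> where "\<zeta> = ?\<zeta>"
    define J where "J = {k - 1, k, k + 1}"
    have J: "k - 1 \<in> J" "k \<in> J" "k + 1 \<in> J" by (auto simp: J_def)
    have vJ: "v j \<in> DB" "w j \<in> DB" "\<lblot>v j\<rblot> \<le> K" "\<lblot>w j\<rblot> \<le> K" if "j \<in> J" for j
      using v that unfolding J_def by blast+
    have \<zeta>_nonneg: "0 \<le> \<zeta>" unfolding \<zeta>_def by simp
    have \<zeta>J: "\<lblot>v j - w j\<rblot> \<le> \<zeta>" if "j \<in> J" for j
      using that unfolding J_def \<zeta>_def by (elim insertE emptyE) simp_all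
    have nv: "norm (v j) \<le> \<beta> * K" "norm (w j) \<le> \<beta> * K" "norm (A (v j)) \<le> b0 * K" "norm (A (w j)) \<le> b0 * K"
      if "j \<in> J" for j
    proof -
      have "\<beta> * \<lblot>v j\<rblot> \<le> \<beta> * K" "\<beta> * \<lblot>w j\<rblot> \<le> \<beta> * K" "b0 * \<lblot>v j\<rblot> \<le> b0 * K" "b0 * \<lblot>w j\<rblot> \<le> b0 * K"
        using vJ[OF that] pos by (simp_all add: mult_left_mono)
      then show "norm (v j) \<le> \<beta> * K" "norm (w j) \<le> \<beta> * K" "norm (A (v j)) \<le> b0 * K" "norm (A (w j)) \<le> b0 * K"
        using \<beta>(2)[OF vJ(1)[OF that]] \<beta>(2)[OF vJ(2)[OF that]] norm_A_le[OF vJ(1)[OF that]] norm_A_le[OF vJ(2)[OF that]]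
        by linarith+
    qed
    have nz: "norm (v j - w j) \<le> \<beta> * \<zeta>" "norm (A (v j) - A (w j)) \<le> b0 * \<zeta>" if "j \<in> J" for j
    proof -
      have "v j - w j \<in> DB" using vJ[OF that] DB_closed by blast
      then show "norm (v j - w j) \<le> \<beta> * \<zeta>"
        using order_trans[OF \<beta>(2) mult_left_mono[OF \<zeta>J[OF that]]] \<beta>(1) by simp
      have "A (v j) - A (w j) = A (v j - w j)" using A_linear(3) vJ[OF that] by simp
      then show "norm (A (v j) - A (w j)) \<le> b0 * \<zeta>"
        using order_trans[OF norm_A_le mult_left_mono[OF \<zeta>J[OF that]]] \<open>v j - w j \<in> DB\<close> b0 by simp
    qed
    have \<gamma>R: "\<gamma> v j \<in> {0..R}" "\<gamma> w j \<in> {0..R}" "\<bar>\<gamma> v j - \<gamma> w j\<bar> \<le> cA * \<zeta>" if "j \<in> J" for j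
    proof -
      have "inner (A (v j)) (v j) \<le> (b0 * K) * (\<beta> * K)" "inner (A (w j)) (w j) \<le> (b0 * K) * (\<beta> * K)"
        using nv[OF that] by (auto intro!: order_trans[OF norm_cauchy_schwarz] mult_mono')
      moreover have "(b0 * K) * (\<beta> * K) \<le> R" by (simp add: R_def power2_eq_square mult_ac)
      ultimately show "\<gamma> v j \<in> {0..R}" "\<gamma> w j \<in> {0..R}"
        using gamma_nonneg[of v j] gamma_nonneg[of w j] gamma_eq[of v j, OF vJ(1)[OF that]] gamma_eq[of w j, OF vJ(2)[OF that]]
        by simp_all
      show "\<bar>\<gamma> v j - \<gamma> w j\<bar> \<le> cA * \<zeta>"
        unfolding gamma_eq[of v j, OF vJ(1)[OF that]] gamma_eq[of w j, OF vJ(2)[OF that]] cA_def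
        by (rule inner_diff_le[OF nv(3) nz(1) nz(2) nv(2)]) (fact that)+
    qed
    have nR: "(norm (v j))\<^sup>2 \<in> {0..R}" "(norm (w j))\<^sup>2 \<in> {0..R}"
      "\<bar>(norm (v j))\<^sup>2 - (norm (w j))\<^sup>2\<bar> \<le> cS * \<zeta>" if "j \<in> J" for j
    proof -
      have "(\<beta> * K)\<^sup>2 \<le> R" by (simp add: R_def power_mult_distrib)
      then show "(norm (v j))\<^sup>2 \<in> {0..R}" "(norm (w j))\<^sup>2 \<in> {0..R}"
        using power_mono[OF nv(1)[OF that], of 2] power_mono[OF nv(2)[OF that], of 2] by simp_all
      show "\<bar>(norm (v j))\<^sup>2 - (norm (w j))\<^sup>2\<bar> \<le> cS * \<zeta>"
        unfolding power2_norm_eq_inner cS_def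
        by (rule inner_diff_le[OF nv(1) nz(1) nz(1) nv(2)]) (fact that)+
    qed
    define sv sw where "sv = v (k + 1) + v (k - 1)" and "sw = w (k + 1) + w (k - 1)"
    define dv dw where "dv = (v (k + 1) - v (k - 1)) /\<^sub>R (2 * \<tau>)" and "dw = (w (k + 1) - w (k - 1)) /\<^sub>R (2 * \<tau>)"
    have DBs: "sv \<in> DB" "sw \<in> DB" using vJ[OF J(1)] vJ[OF J(3)] DB_closed unfolding sv_def sw_def by blast+
    have As: "A sv = A (v (k + 1)) + A (v (k - 1))" "A sw = A (w (k + 1)) + A (w (k - 1))"
      using vJ[OF J(1)] vJ[OF J(3)] A_linear(1) unfolding sv_def sw_def by blast+
    have sbd: "norm sw \<le> 2 * (\<beta> * K)" "norm (A sv) \<le> b0 * (2 * K)" "norm (A sw) \<le> b0 * (2 * K)"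
      using nv[OF J(1)] nv[OF J(3)] unfolding As unfolding sv_def sw_def
      by (auto intro!: order_trans[OF norm_triangle_ineq])
    have \<zeta>13: "\<lblot>v (k + 1) - w (k + 1)\<rblot> + \<lblot>v (k - 1) - w (k - 1)\<rblot> \<le> \<zeta>" unfolding \<zeta>_def by simp
    have sdiff: "norm (sv - sw) \<le> \<beta> * \<zeta>" "norm (A sv - A sw) \<le> b0 * \<zeta>"
    proof -
      let ?z1 = "v (k + 1) - w (k + 1)" and ?z0 = "v (k - 1) - w (k - 1)"
      have z: "?z1 \<in> DB" "?z0 \<in> DB" using vJ[OF J(1)] vJ[OF J(3)] DB_closed by blast+
      have eq: "sv - sw = ?z1 + ?z0" by (simp add: sv_def sw_def)
      have DBz: "sv - sw \<in> DB" using DBs DB_closed by blast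
      have le: "\<lblot>sv - sw\<rblot> \<le> \<zeta>" unfolding eq using energy_norm_linear(1)[OF z] \<zeta>13 by linarith
      show "norm (sv - sw) \<le> \<beta> * \<zeta>"
        using order_trans[OF \<beta>(2)[OF DBz] mult_left_mono[OF le]] \<beta>(1) by simp
      have "A sv - A sw = A (sv - sw)" using A_linear(3)[OF DBs] by simp
      then show "norm (A sv - A sw) \<le> b0 * \<zeta>"
        using order_trans[OF norm_A_le[OF DBz] mult_left_mono[OF le]] b0 by simp
    qed
    have dbd: "norm dv \<le> K" "norm dw \<le> K"
      using central_difference[OF k, of \<tau> v] central_difference[OF k, of \<tau> w] vel unfolding dv_def dw_def by auto
    have ddiff: "norm (dv - dw) \<le> 1 * \<zeta>"
    proof -
      have "dv - dw = ((v (k + 1) - w (k + 1)) - (v (k - 1) - w (k - 1))) /\<^sub>R (2 * \<tau>)"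
        unfolding dv_def dw_def by (simp add: algebra_simps)
      then have "norm (dv - dw) \<le>
        (norm (velocity \<tau> (\<lambda>k. v k - w k) k) + norm (velocity \<tau> (\<lambda>k. v k - w k) (k - 1))) / 2"
        using central_difference[OF k, of \<tau> "\<lambda>k. v k - w k"] by simp
      also have "\<dots> \<le> \<zeta>" unfolding \<zeta>_def by simp
      finally show ?thesis by simp
    qed
    define Dv Dw where "Dv = inner (A sv) dv" and "Dw = inner (A sw) dw"
    have Dbd: "\<bar>Dw\<bar> \<le> b0 * (2 * K) * K" "\<bar>Dv\<bar> \<le> b0 * (2 * K) * K"
      unfolding Dv_def Dw_def using sbd dbd
      by (auto intro!: order_trans[OF Cauchy_Schwarz_ineq2] mult_mono')
    have Ddiff: "\<bar>Dv - Dw\<bar> \<le> cD * \<zeta>" unfolding Dv_def Dw_def cD_def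
      by (rule inner_diff_le[OF sbd(2) ddiff sdiff(2) dbd(2)])
    define qv qw where "qv = integral_mean \<psi>2' (\<gamma> v (k - 1)) (\<gamma> v (k + 1))"
      and "qw = integral_mean \<psi>2' (\<gamma> w (k - 1)) (\<gamma> w (k + 1))"
    have \<gamma>sum: "\<bar>\<gamma> v (k - 1) - \<gamma> w (k - 1)\<bar> + \<bar>\<gamma> v (k + 1) - \<gamma> w (k + 1)\<bar> \<le> 2 * cA * \<zeta>"
      using \<gamma>R(3)[OF J(1)] \<gamma>R(3)[OF J(3)] by linarith
    have nsum: "\<bar>(norm (v (k - 1)))\<^sup>2 - (norm (w (k - 1)))\<^sup>2\<bar> + \<bar>(norm (v (k + 1)))\<^sup>2 - (norm (w (k + 1)))\<^sup>2\<bar> \<le> 2 * cS * \<zeta>"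
      using nR(3)[OF J(1)] nR(3)[OF J(3)] by linarith
    have qbd: "\<bar>qv\<bar> \<le> P2" unfolding qv_def using P2(2) \<gamma>R J by blast
    have qdiff: "\<bar>qv - qw\<bar> \<le> P2 * (2 * cA) * \<zeta>"
    proof -
      have "\<bar>qv - qw\<bar> \<le> P2 * (\<bar>\<gamma> v (k - 1) - \<gamma> w (k - 1)\<bar> + \<bar>\<gamma> v (k + 1) - \<gamma> w (k + 1)\<bar>)"
        unfolding qv_def qw_def using \<gamma>R(1,2)[OF J(1)] \<gamma>R(1,2)[OF J(3)] by (intro P2(3))
      also have "\<dots> \<le> P2 * (2 * cA * \<zeta>)" using \<gamma>sum P2(1) by (intro mult_left_mono) auto
      finally show ?thesis by (simp add: mult.assoc)
    qed
    \<comment> \<open>The decisive identity: no bare division by \<open>\<tau>\<close> remains, only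
      the central difference quotient, bounded by \<open>K\<close> for either solution.\<close>
    have d_eq: "d_coeff \<psi>2 \<tau> DA A x k = integral_mean \<psi>2' (\<gamma> x (k - 1)) (\<gamma> x (k + 1))
        * inner (A (x (k + 1) + x (k - 1))) ((x (k + 1) - x (k - 1)) /\<^sub>R (2 * \<tau>))"
      if x: "x (k - 1) \<in> DB" "x (k + 1) \<in> DB" for x
    proof -
      have h1: "inner (A (x (k + 1) + x (k - 1))) (x (k + 1) - x (k - 1)) = \<gamma> x (k + 1) - \<gamma> x (k - 1)"
        using gamma_diff[OF x] A_linear(2)[OF DB_closed(1)[OF x(2,1)], of "inverse 2"] x by (simp add: gamma_eq)
      have h2: "(\<gamma> x (k + 1) - \<gamma> x (k - 1)) * integral_mean \<psi>2' (\<gamma> x (k - 1)) (\<gamma> x (k + 1))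
        = \<psi>2 (\<gamma> x (k + 1)) - \<psi>2 (\<gamma> x (k - 1))"
        by (rule mult_integral_mean[OF \<psi>2'_cont gamma_nonneg gamma_nonneg \<psi>2'(1)])
      show ?thesis unfolding d_coeff_def h2[symmetric] h1[symmetric] inner_scaleR_right
        by (simp only: divide_inverse mult_ac)
    qed
    have dv_eq: "d_coeff \<psi>2 \<tau> DA A v k = qv * Dv" and dw_eq: "d_coeff \<psi>2 \<tau> DA A w k = qw * Dw"
      using d_eq[of v] d_eq[of w] vJ[OF J(1)] vJ[OF J(3)]
      unfolding qv_def qw_def Dv_def Dw_def sv_def sw_def dv_def dw_def by blast+
    have d_diff: "\<bar>d_coeff \<psi>2 \<tau> DA A v k - d_coeff \<psi>2 \<tau> DA A w k\<bar> \<le> cd * \<zeta>"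
      unfolding dv_eq dw_eq cd_def
      by (rule norm_scaleR_diff_le[where a = Dv and b = Dw, unfolded real_norm_def real_scaleR_def,
            OF qbd Ddiff qdiff Dbd(1)])
    have d_bd: "\<bar>d_coeff \<psi>2 \<tau> DA A v k\<bar> \<le> P2 * (b0 * (2 * K) * K)"
      unfolding dv_eq abs_mult using qbd Dbd(2) by (intro mult_mono') auto
    have a1_bd: "\<bar>a1_coeff \<psi>1 DA A v k\<bar> \<le> P1" unfolding a1_coeff_def using P1(2) \<gamma>R J by blast
    have a1_diff: "\<bar>a1_coeff \<psi>1 DA A v k - a1_coeff \<psi>1 DA A w k\<bar> \<le> P1 * (2 * cA) * \<zeta>"
    proof -
      have "\<bar>a1_coeff \<psi>1 DA A v k - a1_coeff \<psi>1 DA A w k\<bar>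
        \<le> P1 * (\<bar>\<gamma> v (k - 1) - \<gamma> w (k - 1)\<bar> + \<bar>\<gamma> v (k + 1) - \<gamma> w (k + 1)\<bar>)"
        unfolding a1_coeff_def using \<gamma>R(1,2)[OF J(1)] \<gamma>R(1,2)[OF J(3)] by (intro P1(3))
      also have "\<dots> \<le> P1 * (2 * cA * \<zeta>)" using \<gamma>sum P1(1) by (intro mult_left_mono) auto
      finally show ?thesis by (simp add: mult.assoc)
    qed
    have a3_bd: "\<bar>a3_coeff \<psi>3 v k\<bar> \<le> P3" unfolding a3_coeff_def using P3(2) nR J by blast
    have a3_diff: "\<bar>a3_coeff \<psi>3 v k - a3_coeff \<psi>3 w k\<bar> \<le> P3 * (2 * cS) * \<zeta>"
    proof -
      have "\<bar>a3_coeff \<psi>3 v k - a3_coeff \<psi>3 w k\<bar>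
        \<le> P3 * (\<bar>(norm (v (k - 1)))\<^sup>2 - (norm (w (k - 1)))\<^sup>2\<bar> + \<bar>(norm (v (k + 1)))\<^sup>2 - (norm (w (k + 1)))\<^sup>2\<bar>)"
        unfolding a3_coeff_def using nR(1,2)[OF J(1)] nR(1,2)[OF J(3)] by (intro P3(3))
      also have "\<dots> \<le> P3 * (2 * cS * \<zeta>)" using nsum P3(1) by (intro mult_left_mono) auto
      finally show ?thesis by (simp add: mult.assoc)
    qed
    define \<alpha>v \<alpha>w where "\<alpha>v = a1_coeff \<psi>1 DA A v k + d_coeff \<psi>2 \<tau> DA A v k"
      and "\<alpha>w = a1_coeff \<psi>1 DA A w k + d_coeff \<psi>2 \<tau> DA A w k"
    have \<alpha>: "\<bar>\<alpha>v\<bar> \<le> Q" "\<bar>\<alpha>v - \<alpha>w\<bar> \<le> (P1 * (2 * cA) + cd) * \<zeta>"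
      using a1_bd d_bd a1_diff d_diff unfolding \<alpha>v_def \<alpha>w_def Q_def distrib_right by linarith+
    \<comment> \<open>The factor one half is simply given away.\<close>
    have half: "norm (x /\<^sub>R 2) \<le> b" if "norm x \<le> b" for x :: 'a and b
      using order_trans[OF norm_ge_zero that] that by simp
    have t1: "norm (\<alpha>v *\<^sub>R A (sv /\<^sub>R 2) - \<alpha>w *\<^sub>R A (sw /\<^sub>R 2)) \<le> (Q * b0 + (P1 * (2 * cA) + cd) * (b0 * K)) * \<zeta>"
    proof (rule norm_scaleR_diff_le[OF \<alpha>(1) _ \<alpha>(2)])
      show "norm (A (sw /\<^sub>R 2)) \<le> b0 * K" using sbd(3) A_linear(2)[OF DBs(2)] by simp
      have "A (sv /\<^sub>R 2) - A (sw /\<^sub>R 2) = (A sv - A sw) /\<^sub>R 2"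
        using A_linear(2) DBs by (simp add: scaleR_diff_right)
      then show "norm (A (sv /\<^sub>R 2) - A (sw /\<^sub>R 2)) \<le> b0 * \<zeta>" using half[OF sdiff(2)] by (simp only:)
    qed
    have t2: "norm (a3_coeff \<psi>3 v k *\<^sub>R (sv /\<^sub>R 2) - a3_coeff \<psi>3 w k *\<^sub>R (sw /\<^sub>R 2)) \<le> (P3 * \<beta> + P3 * (2 * cS) * (\<beta> * K)) * \<zeta>"
    proof (rule norm_scaleR_diff_le[OF a3_bd _ a3_diff])
      show "norm (sw /\<^sub>R 2) \<le> \<beta> * K" using sbd(1) by simp
      have "sv /\<^sub>R 2 - sw /\<^sub>R 2 = (sv - sw) /\<^sub>R 2" by (simp add: scaleR_diff_right)
      then show "norm (sv /\<^sub>R 2 - sw /\<^sub>R 2) \<le> \<beta> * \<zeta>" using half[OF sdiff(1)] by (simp only:)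
    qed
    have t3: "norm (C (v k) - C (w k)) \<le> a0 * b0 * \<zeta>"
    proof -
      have "norm (C (v k - w k)) \<le> a0 * b0 * \<lblot>v k - w k\<rblot>"
        using vJ[OF J(2)] DB_closed by (intro norm_C_le) blast
      also have "\<dots> \<le> a0 * b0 * \<zeta>" using \<zeta>J[OF J(2)] a0 b0 by (intro mult_left_mono) auto
      finally show ?thesis using C_diff vJ[OF J(2)] by simp
    qed
    have t4: "norm (N dv - N dw) \<le> \<nu> * \<zeta>"
    proof -
      have "norm (N (dv - dw)) \<le> norm (dv - dw) * \<nu>" by (rule \<nu>(2))
      also have "\<dots> \<le> \<zeta> * \<nu>" using ddiff \<nu>(1) by (intro mult_right_mono) auto
      finally show ?thesis using linear_diff[OF bounded_linear.linear[OF bl_N]] by (simp add: mult.commute)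
    qed
    have t5: "norm (M (v k) - M (w k)) \<le> L * \<beta> * \<zeta>"
      using order_trans[OF L(2) mult_left_mono[OF nz(1)[OF J(2)]]] L(1) by (simp add: mult.assoc)
    have "lower_terms \<tau> v k - lower_terms \<tau> w k = (\<alpha>v *\<^sub>R A (sv /\<^sub>R 2) - \<alpha>w *\<^sub>R A (sw /\<^sub>R 2))
      + (a3_coeff \<psi>3 v k *\<^sub>R (sv /\<^sub>R 2) - a3_coeff \<psi>3 w k *\<^sub>R (sw /\<^sub>R 2))
      + (C (v k) - C (w k)) + (N dv - N dw) + (M (v k) - M (w k))"
      by (simp only: lower_terms_def \<alpha>v_def \<alpha>w_def sv_def sw_def dv_def dw_def add_diff_add)
    also have "norm \<dots> \<le> (Q * b0 + (P1 * (2 * cA) + cd) * (b0 * K)) * \<zeta>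
      + (P3 * \<beta> + P3 * (2 * cS) * (\<beta> * K)) * \<zeta> + a0 * b0 * \<zeta> + \<nu> * \<zeta> + L * \<beta> * \<zeta>"
      by (intro norm_triangle_le add_mono t1 t2 t3 t4 t5)
    also have "\<dots> = c * \<zeta>" by (simp only: c_def distrib_right)
    finally show ?thesis unfolding \<zeta>_def .
  qed
  ultimately show ?thesis by blast
qed


section \<open>Bounds for the solutions independent of the number of steps\<close>

text \<open>The nonlinear coefficients need no prior bound here: those of \<open>\<psi>1\<close> and
  \<open>\<psi>3\<close> do work equal to a potential increment, and that of \<open>\<psi>2\<close>
  has a sign. What remains grows at most linearly in the energy norm and the velocity.\<close>

lemma a_priori_bound:
  fixes u f :: "nat \<Rightarrow> nat \<Rightarrow> 'a"
  assumes T: "0 < T"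
    and sol: "solves_scheme \<psi>1 \<psi>2 \<psi>3 a1 a2 DA A DB B C N M T u f"
    and data: "bounded_data DB B T u f"
  shows "\<exists>K>0. \<exists>n0. \<forall>n\<ge>n0. 1 < n \<longrightarrow> (\<forall>k\<le>n. u n k \<in> DB \<and> \<lblot>u n k\<rblot> \<le> K) \<and>
    (\<forall>k<n. norm (velocity (T / real n) (u n) k) \<le> K)"
proof -
  obtain K0 where "\<forall>n>1. \<lblot>u n 0\<rblot> \<le> K0 \<and> \<lblot>u n 1\<rblot> \<le> K0 \<and>
    norm ((u n 1 - u n 0) /\<^sub>R (T / real n)) \<le> K0 \<and> (\<forall>k\<in>{1..n - 1}. norm (f n k) \<le> K0)"
    using data unfolding bounded_data_def by blast
  then have K0: "\<And>n. 1 < n \<Longrightarrow> \<lblot>u n 0\<rblot> \<le> K0" "\<And>n. 1 < n \<Longrightarrow> \<lblot>u n 1\<rblot> \<le> K0"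
    "\<And>n. 1 < n \<Longrightarrow> norm (velocity (T / real n) (u n) 0) \<le> K0"
    "\<And>n k. 1 < n \<Longrightarrow> k \<in> {1..n - 1} \<Longrightarrow> norm (f n k) \<le> K0"
    unfolding add_0 by blast+
  \<comment> \<open>Any admissible number of steps would do; \<open>2\<close> is the
    smallest.\<close>
  have K0_nonneg: "0 \<le> K0" using K0(1)[of 2] norm_ge_zero[of "sqrt_operator DB B (u 2 0)"] by linarith
  have DBu: "u n k \<in> DB" if "1 < n" "k \<le> n" for n k using sol that unfolding solves_scheme_def by blast
  obtain \<beta> where \<beta>: "0 < \<beta>" "\<And>v. v \<in> DB \<Longrightarrow> norm v \<le> \<beta> * \<lblot>v\<rblot>" using norm_le_energy_norm by blast
  obtain L where L: "0 < L" "\<And>x y. norm (M x - M y) \<le> L * norm (x - y)" using M_Lipschitz by blast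
  obtain \<nu> where \<nu>: "0 < \<nu>" "\<And>x. norm (N x) \<le> norm x * \<nu>" using bounded_linear.pos_bounded[OF bl_N] by blast
  have cont: "continuous_on {0..} \<psi>1" "continuous_on {0..} \<psi>3"
    using C2_on_imp_C1[OF \<psi>1(1)] C2_on_imp_C1[OF \<psi>3(1)] by (metis DERIV_continuous_on atLeast_iff)+
  obtain F1 where F1: "\<And>s. 0 \<le> s \<Longrightarrow> (F1 has_real_derivative \<psi>1 s) (at s within {0..})" "\<And>s. 0 \<le> s \<Longrightarrow> 0 \<le> F1 s"
    using antiderivative_exists[OF cont(1) \<psi>1(2)] by blast
  obtain F3 where F3: "\<And>s. 0 \<le> s \<Longrightarrow> (F3 has_real_derivative \<psi>3 s) (at s within {0..})" "\<And>s. 0 \<le> s \<Longrightarrow> 0 \<le> F3 s"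
    using antiderivative_exists[OF cont(2) \<psi>3(2)] by blast
  \<comment> \<open>Built from the data bound \<open>K0\<close>, this interval contains the
    arguments of \<open>F1\<close> and \<open>F3\<close> on the two initial layers only; it serves
    to bound the initial energy.\<close>
  define R where "R = max (b0 * K0 * (\<beta> * K0)) ((\<beta> * K0)\<^sup>2)"
  have bdd: "\<exists>H. \<forall>s\<in>{0..R}. F s \<le> H" if "\<And>s. 0 \<le> s \<Longrightarrow> (F has_real_derivative \<psi> s) (at s within {0..})"
    for F \<psi> :: "real \<Rightarrow> real"
  proof -
    have "continuous_on {0..} F" using that by (intro DERIV_continuous_on) auto
    then have "compact (F ` {0..R})"
      by (intro compact_continuous_image) (auto intro: continuous_on_subset)
    then have "bdd_above (F ` {0..R})" by (intro bounded_imp_bdd_above compact_imp_bounded)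
    then show ?thesis unfolding bdd_above_def by blast
  qed
  obtain H1 where H1: "\<And>s. s \<in> {0..R} \<Longrightarrow> F1 s \<le> H1" using bdd[OF F1(1)] by blast
  obtain H3 where H3: "\<And>s. s \<in> {0..R} \<Longrightarrow> F3 s \<le> H3" using bdd[OF F3(1)] by blast
  define \<kappa> where "\<kappa> = 2 * sqrt (2 / a2) + 1"
  have \<kappa>: "0 < \<kappa>" using a2 by (simp add: \<kappa>_def add_nonneg_pos)
  \<comment> \<open>A Lipschitz \<open>M\<close> is affinely bounded, so \<open>norm (M 0)\<close>
    joins the data.\<close>
  define \<Phi> where "\<Phi> = K0 + norm (M 0)"
  have \<Phi>: "0 \<le> \<Phi>" using K0_nonneg by (simp add: \<Phi>_def)
  define c where "c = a0 * b0 + L * \<beta> + \<nu>"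
  have c: "0 < c" unfolding c_def using a0 b0 L(1) \<beta>(1) \<nu>(1) by (simp add: add_pos_pos)
  \<comment> \<open>\<open>S\<close> bounds the initial energy, and \<open>K\<close> is then the
    value of the energy estimate, with \<open>1\<close> inserted for positivity.\<close>
  define S where "S = K0\<^sup>2 + a2 / 2 * (K0\<^sup>2 + K0\<^sup>2) + (H1 + H3)"
  define K where "K = max 1 (\<kappa> * exp (4 * c * \<kappa> * T) * (sqrt S + 2 * T * \<Phi>))"
  have "0 \<le> c * \<kappa>" using c \<kappa> by simp
  then obtain n0 where n0: "\<And>n. n0 \<le> n \<Longrightarrow> 1 < n \<Longrightarrow> c * \<kappa> * (T / real n) \<le> 1 / 2"
    using ex_nat_step_small by blast
  have main: "\<lblot>u n (k + 1)\<rblot> + \<lblot>u n k\<rblot> + norm (velocity (T / real n) (u n) k) \<le> K"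
    if n: "n0 \<le> n" "1 < n" and k: "k < n" for n k
  proof -
    define \<tau> where "\<tau> = T / real n"
    have \<tau>: "0 < \<tau>" "real n * \<tau> = T" using T n by (simp_all add: \<tau>_def)
    define v where "v = u n"
    have v: "v k \<in> DB" if "k \<le> n" for k using DBu n(2) that by (simp add: v_def)
    \<comment> \<open>Averaging over two layers makes the increment of \<open>W\<close> span the
      layers \<open>i - 1\<close> and \<open>i + 1\<close>, as the integral means do.\<close>
    define W where "W k = (F1 (\<gamma> v (k + 1)) + F1 (\<gamma> v k)) / 2
      + (F3 ((norm (v (k + 1)))\<^sup>2) + F3 ((norm (v k))\<^sup>2)) / 2" for k
    \<comment> \<open>The terms with a potential or a sign go to \<open>r\<close>; those with
      \<open>C\<close>, \<open>N\<close> and \<open>M\<close> go to \<open>g\<close> and are treated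
      as perturbations.\<close>
    define r where "r k = (a1_coeff \<psi>1 DA A v k + d_coeff \<psi>2 \<tau> DA A v k) *\<^sub>R A ((v (k + 1) + v (k - 1)) /\<^sub>R 2)
     + a3_coeff \<psi>3 v k *\<^sub>R ((v (k + 1) + v (k - 1)) /\<^sub>R 2)" for k
    define g where "g k = f n k - (C (v k) + N ((v (k + 1) - v (k - 1)) /\<^sub>R (2 * \<tau>)) + M (v k))" for k
    define E0 where "E0 = (norm (velocity \<tau> v 0))\<^sup>2 + a2 / 2 * (\<lblot>v 1\<rblot>\<^sup>2 + \<lblot>v 0\<rblot>\<^sup>2) + W 0"
    have "\<lblot>v (k + 1)\<rblot> + \<lblot>v k\<rblot> + norm (velocity \<tau> v k)
      \<le> \<kappa> * exp (4 * c * \<kappa> * T) * (sqrt E0 + 2 * \<tau> * (\<Sum>i=1..k. \<Phi>))"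
      unfolding \<kappa>_def E0_def
    proof (rule energy_estimate[where n = n and r = r and g = g])
      show "c * (2 * sqrt (2 / a2) + 1) * \<tau> \<le> 1 / 2" using n0[OF n] unfolding \<tau>_def \<kappa>_def .
      show "0 \<le> W i" for i unfolding W_def using F1(2) F3(2) gamma_nonneg by simp
      fix i assume i: "i \<in> {1..n - 1}"
      then have i1: "1 \<le> i" "i \<le> n" "i - 1 \<le> n" "i + 1 \<le> n" "i - 1 + 1 = i" by auto
      let ?x = "v (i - 1)" and ?w = "v (i + 1)"
      have x: "?x \<in> DB" "?w \<in> DB" using v i1 by blast+
      have "scheme_lhs \<psi>1 \<psi>2 \<psi>3 a1 a2 DA A B C N M \<tau> v i = f n i"
        using sol n(2) i unfolding solves_scheme_def v_def \<tau>_def by blast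
      then show "(?w - 2 *\<^sub>R v i + ?x) /\<^sub>R \<tau>\<^sup>2 + a1 *\<^sub>R B ((?w - ?x) /\<^sub>R (2 * \<tau>))
        + a2 *\<^sub>R B ((?w + ?x) /\<^sub>R 2) + r i = g i"
        unfolding scheme_lhs_eq lower_terms_def r_def g_def eq_diff_eq by (simp only: add.assoc)
      show "W i - W (i - 1) \<le> inner (r i) (?w - ?x)"
      proof -
        have half: "inner ((?w + ?x) /\<^sub>R 2) (?w - ?x) = ((norm ?w)\<^sup>2 - (norm ?x)\<^sup>2) / 2"
          by (simp add: power2_norm_eq_inner inner_simps inner_commute)
        have comb: "inner (a *\<^sub>R p + b *\<^sub>R q) d = a * inner p d + b * inner q d" for a b and p q d :: 'a
          by (simp add: inner_simps)
        have r: "inner (r i) (?w - ?x) = a1_coeff \<psi>1 DA A v i * (\<gamma> v (i + 1) - \<gamma> v (i - 1)) / 2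
          + d_coeff \<psi>2 \<tau> DA A v i * (\<gamma> v (i + 1) - \<gamma> v (i - 1)) / 2
          + a3_coeff \<psi>3 v i * ((norm ?w)\<^sup>2 - (norm ?x)\<^sup>2) / 2"
          unfolding r_def comb half gamma_diff[OF x] gamma_eq[of v "i + 1", OF x(2)] gamma_eq[of v "i - 1", OF x(1)]
          by (simp only: distrib_right times_divide_eq_right add_divide_distrib)
        have F1_diff: "a1_coeff \<psi>1 DA A v i * (\<gamma> v (i + 1) - \<gamma> v (i - 1)) = F1 (\<gamma> v (i + 1)) - F1 (\<gamma> v (i - 1))"
          using mult_integral_mean[OF cont(1) gamma_nonneg gamma_nonneg F1(1)]
          unfolding a1_coeff_def by (simp add: mult.commute)
        have F3_diff: "a3_coeff \<psi>3 v i * ((norm ?w)\<^sup>2 - (norm ?x)\<^sup>2) = F3 ((norm ?w)\<^sup>2) - F3 ((norm ?x)\<^sup>2)"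
          using mult_integral_mean[OF cont(2) _ _ F3(1), of "(norm ?x)\<^sup>2" "(norm ?w)\<^sup>2"]
          unfolding a3_coeff_def by (simp add: mult.commute)
        \<comment> \<open>\<open>d_coeff\<close> is itself the increment of \<open>\<psi>2\<close>
          over \<open>2 * \<tau>\<close>, so it has the sign of the increment of
          \<open>\<gamma>\<close>.\<close>
        have d: "0 \<le> d_coeff \<psi>2 \<tau> DA A v i * (\<gamma> v (i + 1) - \<gamma> v (i - 1))"
          using mono_on_diff_mult_nonneg[OF \<psi>2(2), of "\<gamma> v (i - 1)" "\<gamma> v (i + 1)"] gamma_nonneg \<tau>(1)
          unfolding d_coeff_def by simp
        have W_diff: "W i - W (i - 1) = (F1 (\<gamma> v (i + 1)) - F1 (\<gamma> v (i - 1))) / 2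
          + (F3 ((norm ?w)\<^sup>2) - F3 ((norm ?x)\<^sup>2)) / 2"
          unfolding W_def i1(5) by (simp add: field_simps)
        show ?thesis unfolding W_diff r F1_diff F3_diff using d by simp
      qed
      define \<zeta> where "\<zeta> = \<lblot>?w\<rblot> + \<lblot>v i\<rblot> + \<lblot>?x\<rblot> + norm (velocity \<tau> v i) + norm (velocity \<tau> v (i - 1))"
      have \<zeta>: "\<lblot>v i\<rblot> \<le> \<zeta>" "(norm (velocity \<tau> v i) + norm (velocity \<tau> v (i - 1))) / 2 \<le> \<zeta>"
        unfolding \<zeta>_def by simp_all
      have "norm (C (v i)) \<le> a0 * b0 * \<zeta>"
        using order_trans[OF norm_C_le[OF v[OF i1(2)]] mult_left_mono[OF \<zeta>(1)]] a0 b0 by simp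
      moreover have "norm (N ((?w - ?x) /\<^sub>R (2 * \<tau>))) \<le> \<nu> * \<zeta>"
        using order_trans[OF \<nu>(2) mult_right_mono[OF order_trans[OF central_difference[OF i1(1)] \<zeta>(2)]]] \<nu>(1)
        by (simp add: mult.commute)
      moreover have "norm (M (v i)) \<le> norm (M 0) + L * \<beta> * \<zeta>"
      proof -
        have "norm (M (v i)) \<le> norm (M 0) + norm (M (v i) - M 0)" by (metis norm_triangle_sub)
        moreover have "norm (M (v i) - M 0) \<le> L * norm (v i)" using L(2)[of "v i" 0] by simp
        moreover have "norm (v i) \<le> \<beta> * \<zeta>"
          using order_trans[OF \<beta>(2)[OF v[OF i1(2)]] mult_left_mono[OF \<zeta>(1)]] \<beta>(1) by simp
        then have "L * norm (v i) \<le> L * \<beta> * \<zeta>" using L(1) by (simp add: mult.assoc mult_left_mono)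
        ultimately show ?thesis by linarith
      qed
      moreover have "norm (f n i) \<le> K0" using K0(4) n(2) i by blast
      moreover have "norm (g i) \<le> norm (f n i) + (norm (C (v i)) + norm (N ((?w - ?x) /\<^sub>R (2 * \<tau>))) + norm (M (v i)))"
        unfolding g_def by (intro norm_triangle_le_diff add_mono norm_triangle_le order_refl)
      ultimately show "norm (g i) \<le> \<Phi> + c * \<zeta>"
        unfolding \<Phi>_def c_def distrib_right by linarith
    qed (use \<tau> c v \<Phi> k in auto)
    also have "\<dots> \<le> \<kappa> * exp (4 * c * \<kappa> * T) * (sqrt S + 2 * T * \<Phi>)"
    proof (intro mult_left_mono add_mono real_sqrt_le_mono)
      have initial: "\<gamma> v j \<in> {0..R}" "(norm (v j))\<^sup>2 \<in> {0..R}" if "j \<in> {0, 1}" for j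
      proof -
        have "j \<le> n" "\<lblot>v j\<rblot> \<le> K0" using that K0(1,2)[OF n(2)] n(2) by (auto simp: v_def)
        note vj = v[OF this(1)]
        have nv: "norm (v j) \<le> \<beta> * K0" "norm (A (v j)) \<le> b0 * K0"
          using order_trans[OF \<beta>(2)[OF vj] mult_left_mono[OF \<open>\<lblot>v j\<rblot> \<le> K0\<close>]]
            order_trans[OF norm_A_le[OF vj] mult_left_mono[OF \<open>\<lblot>v j\<rblot> \<le> K0\<close>]] \<beta>(1) b0 by simp_all
        have "inner (A (v j)) (v j) \<le> b0 * K0 * (\<beta> * K0)"
          using nv by (auto intro!: order_trans[OF norm_cauchy_schwarz] mult_mono')
        then show "\<gamma> v j \<in> {0..R}" using gamma_nonneg[of v j] unfolding gamma_eq[of v j, OF vj] R_def by simp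
        show "(norm (v j))\<^sup>2 \<in> {0..R}" using power_mono[OF nv(1), of 2] unfolding R_def by simp
      qed
      have "F1 (\<gamma> v 0) \<le> H1" "F1 (\<gamma> v 1) \<le> H1" "F3 ((norm (v 0))\<^sup>2) \<le> H3" "F3 ((norm (v 1))\<^sup>2) \<le> H3"
        using initial by (auto intro!: H1 H3 simp del: atLeastAtMost_iff)
      then have "W 0 \<le> H1 + H3" unfolding W_def add_0 add_divide_distrib by linarith
      moreover have "(norm (velocity \<tau> v 0))\<^sup>2 \<le> K0\<^sup>2" "\<lblot>v 1\<rblot>\<^sup>2 \<le> K0\<^sup>2" "\<lblot>v 0\<rblot>\<^sup>2 \<le> K0\<^sup>2"
        using K0(1-3)[OF n(2)] unfolding v_def \<tau>_def by (auto intro: power_mono)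
      moreover from this have "a2 / 2 * (\<lblot>v 1\<rblot>\<^sup>2 + \<lblot>v 0\<rblot>\<^sup>2) \<le> a2 / 2 * (K0\<^sup>2 + K0\<^sup>2)"
        using a2 by (intro mult_left_mono add_mono) auto
      ultimately show "E0 \<le> S" unfolding E0_def S_def by linarith
      \<comment> \<open>The constant source accumulates over at most the whole time
        \<open>T\<close>.\<close>
      have "real k * \<tau> \<le> real n * \<tau>" using k \<tau>(1) by (intro mult_right_mono) auto
      then have "2 * (real k * \<tau>) * \<Phi> \<le> 2 * T * \<Phi>" using \<Phi> \<tau>(2) by (intro mult_right_mono) auto
      then show "2 * \<tau> * (\<Sum>i=1..k. \<Phi>) \<le> 2 * T * \<Phi>" by (simp add: mult_ac)
    qed (use \<kappa> in auto)
    finally show ?thesis unfolding K_def v_def \<tau>_def by (simp add: le_max_iff_disj)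
  qed
  have "0 < K" by (simp add: K_def)
  have "u n k \<in> DB \<and> \<lblot>u n k\<rblot> \<le> K" if "n0 \<le> n" "1 < n" "k \<le> n" for n k
  \<comment> \<open>\<open>main\<close> controls the layers \<open>k\<close> and
    \<open>k + 1\<close> for \<open>k < n\<close>; the last layer is reached only as a
    successor.\<close>
  proof (cases k)
    case 0
    have "\<lblot>u n 0\<rblot> \<le> \<lblot>u n (0 + 1)\<rblot> + \<lblot>u n 0\<rblot> + norm (velocity (T / real n) (u n) 0)" by simp
    also have "\<dots> \<le> K" by (rule main) (use that in auto)
    finally show ?thesis using DBu that 0 by simp
  next
    case (Suc j)
    have "\<lblot>u n (j + 1)\<rblot> \<le> \<lblot>u n (j + 1)\<rblot> + \<lblot>u n j\<rblot> + norm (velocity (T / real n) (u n) j)" by simp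
    also have "\<dots> \<le> K" by (rule main) (use that Suc in auto)
    finally show ?thesis using DBu that Suc by simp
  qed
  moreover have "norm (velocity (T / real n) (u n) k) \<le> K" if "n0 \<le> n" "1 < n" "k < n" for n k
  proof -
    have "norm (velocity (T / real n) (u n) k) \<le> \<lblot>u n (k + 1)\<rblot> + \<lblot>u n k\<rblot> + norm (velocity (T / real n) (u n) k)" by simp
    also have "\<dots> \<le> K" by (rule main) (use that in auto)
    finally show ?thesis .
  qed
  ultimately show ?thesis using \<open>0 < K\<close> by blast
qed

section \<open>The difference of two solutions\<close>

text \<open>Both solutions stay in one bounded set, where the difference of their lower terms is at
  most a constant times the energy quantities of \<open>z\<close>. The energy estimate thus applies
  with \<open>r\<close> and \<open>W\<close> zero and everything else in \<open>g\<close>.\<close>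

lemma stability:
  fixes u ubar f fbar :: "nat \<Rightarrow> nat \<Rightarrow> 'a"
  assumes T: "0 < T"
    and sol: "solves_scheme \<psi>1 \<psi>2 \<psi>3 a1 a2 DA A DB B C N M T u f"
      "solves_scheme \<psi>1 \<psi>2 \<psi>3 a1 a2 DA A DB B C N M T ubar fbar"
    and data: "bounded_data DB B T u f" "bounded_data DB B T ubar fbar"
  shows "\<exists>c>0. \<exists>n0. \<forall>n\<ge>n0. 1 < n \<longrightarrow> (\<forall>k\<in>{1..n - 1}.
    \<lblot>u n (k + 1) - ubar n (k + 1)\<rblot> + norm (velocity (T / real n) (\<lambda>k. u n k - ubar n k) k)
    \<le> c * (\<lblot>u n 0 - ubar n 0\<rblot> + norm (velocity (T / real n) (\<lambda>k. u n k - ubar n k) 0)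
      + T / real n * \<lblot>velocity (T / real n) (\<lambda>k. u n k - ubar n k) 0\<rblot>
      + T / real n * (\<Sum>i=1..k. norm (f n i - fbar n i))))"
proof -
  obtain K1 n1 where K1: "K1 > 0" "\<And>n k. n1 \<le> n \<Longrightarrow> 1 < n \<Longrightarrow> k \<le> n \<Longrightarrow> u n k \<in> DB \<and> \<lblot>u n k\<rblot> \<le> K1"
    "\<And>n k. n1 \<le> n \<Longrightarrow> 1 < n \<Longrightarrow> k < n \<Longrightarrow> norm (velocity (T / real n) (u n) k) \<le> K1"
    using a_priori_bound[OF T sol(1) data(1)] by blast
  obtain K2 n2 where K2: "K2 > 0" "\<And>n k. n2 \<le> n \<Longrightarrow> 1 < n \<Longrightarrow> k \<le> n \<Longrightarrow> ubar n k \<in> DB \<and> \<lblot>ubar n k\<rblot> \<le> K2"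
    "\<And>n k. n2 \<le> n \<Longrightarrow> 1 < n \<Longrightarrow> k < n \<Longrightarrow> norm (velocity (T / real n) (ubar n) k) \<le> K2"
    using a_priori_bound[OF T sol(2) data(2)] by blast
  define K where "K = max K1 K2"
  have K: "0 < K" "K1 \<le> K" "K2 \<le> K" using K1(1) by (auto simp: K_def)
  obtain c where c: "c > 0" "\<And>v w k \<tau>. 1 \<le> k \<Longrightarrow> 0 < \<tau> \<Longrightarrow>
    (\<forall>j\<in>{k - 1, k, k + 1}. v j \<in> DB \<and> w j \<in> DB \<and> \<lblot>v j\<rblot> \<le> K \<and> \<lblot>w j\<rblot> \<le> K) \<Longrightarrow>
    (\<forall>j\<in>{k - 1, k}. norm (velocity \<tau> v j) \<le> K \<and> norm (velocity \<tau> w j) \<le> K) \<Longrightarrow>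
    norm (lower_terms \<tau> v k - lower_terms \<tau> w k)
      \<le> c * (\<lblot>v (k + 1) - w (k + 1)\<rblot> + \<lblot>v k - w k\<rblot> + \<lblot>v (k - 1) - w (k - 1)\<rblot>
        + norm (velocity \<tau> (\<lambda>k. v k - w k) k) + norm (velocity \<tau> (\<lambda>k. v k - w k) (k - 1)))"
    using lower_terms_Lipschitz[OF K(1)] by blast
  define \<kappa> where "\<kappa> = 2 * sqrt (2 / a2) + 1"
  have \<kappa>: "0 < \<kappa>" using a2 by (simp add: \<kappa>_def add_nonneg_pos)
  have "0 \<le> c * \<kappa>" using c(1) \<kappa> by simp
  then obtain n3 where n3: "\<And>n. n3 \<le> n \<Longrightarrow> 1 < n \<Longrightarrow> c * \<kappa> * (T / real n) \<le> 1 / 2"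
    using ex_nat_step_small by blast
  \<comment> \<open>The reciprocal of the \<open>\<sigma>\<close> in \<open>energy_estimate\<close>:
    here energy norms bound the initial energy from above.\<close>
  define \<sigma> where "\<sigma> = sqrt (a2 / 2)"
  have \<sigma>: "0 \<le> \<sigma>" using a2 by (simp add: \<sigma>_def)
  define G where "G = \<kappa> * exp (4 * c * \<kappa> * T)"
  have G: "0 < G" using \<kappa> by (simp add: G_def)
  \<comment> \<open>\<open>G\<close> is the factor of the energy estimate.
    \<open>2 + 2 * \<sigma>\<close> majorises the weights \<open>1\<close>,
    \<open>2 * \<sigma>\<close>, \<open>\<sigma>\<close> and \<open>2\<close> with which the initial
    velocity, the initial value, its scaled energy norm and the data sum occur.\<close>
  have "\<lblot>u n (k + 1) - ubar n (k + 1)\<rblot> + norm (velocity (T / real n) (\<lambda>k. u n k - ubar n k) k)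
    \<le> G * (2 + 2 * \<sigma>) * (\<lblot>u n 0 - ubar n 0\<rblot> + norm (velocity (T / real n) (\<lambda>k. u n k - ubar n k) 0)
      + T / real n * \<lblot>velocity (T / real n) (\<lambda>k. u n k - ubar n k) 0\<rblot>
      + T / real n * (\<Sum>i=1..k. norm (f n i - fbar n i)))"
    if n: "max n1 (max n2 n3) \<le> n" "1 < n" and k: "k \<in> {1..n - 1}" for n k
  proof -
    define \<tau> where "\<tau> = T / real n"
    have \<tau>: "0 < \<tau>" "real n * \<tau> = T" using T n by (simp_all add: \<tau>_def)
    define v w z where "v = u n" and "w = ubar n" and "z = (\<lambda>k. v k - w k)"
    have vw: "v k \<in> DB" "w k \<in> DB" "\<lblot>v k\<rblot> \<le> K" "\<lblot>w k\<rblot> \<le> K" if "k \<le> n" for k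
      using K1(2)[of n k] K2(2)[of n k] n that K unfolding v_def w_def by auto
    have vel: "norm (velocity \<tau> v k) \<le> K" "norm (velocity \<tau> w k) \<le> K" if "k < n" for k
      using K1(3)[of n k] K2(3)[of n k] n that K unfolding v_def w_def \<tau>_def by auto
    have z: "z k \<in> DB" if "k \<le> n" for k unfolding z_def using vw(1,2)[OF that] DB_closed by blast
    define \<phi> where "\<phi> i = norm (f n i - fbar n i)" for i
    define g where "g k = (f n k - fbar n k) - (lower_terms \<tau> v k - lower_terms \<tau> w k)" for k
    define E0 where "E0 = (norm (velocity \<tau> z 0))\<^sup>2 + a2 / 2 * (\<lblot>z 1\<rblot>\<^sup>2 + \<lblot>z 0\<rblot>\<^sup>2) + 0"
    have "\<lblot>z (k + 1)\<rblot> + \<lblot>z k\<rblot> + norm (velocity \<tau> z k)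
      \<le> \<kappa> * exp (4 * c * \<kappa> * T) * (sqrt E0 + 2 * \<tau> * (\<Sum>i=1..k. \<phi> i))"
      unfolding \<kappa>_def E0_def
    proof (rule energy_estimate[where n = n and r = "\<lambda>_. 0" and g = g and W = "\<lambda>_. 0"])
      show "c * (2 * sqrt (2 / a2) + 1) * \<tau> \<le> 1 / 2" using n3[of n] n unfolding \<tau>_def \<kappa>_def by simp
      fix i assume i: "i \<in> {1..n - 1}"
      then have i1: "1 \<le> i" "i \<le> n" "i - 1 \<le> n" "i + 1 \<le> n" "i - 1 + 1 = i" "i < n" "i - 1 < n" by auto
      have eqs: "(v (i + 1) - 2 *\<^sub>R v i + v (i - 1)) /\<^sub>R \<tau>\<^sup>2 + a1 *\<^sub>R B ((v (i + 1) - v (i - 1)) /\<^sub>R (2 * \<tau>))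
        + a2 *\<^sub>R B ((v (i + 1) + v (i - 1)) /\<^sub>R 2) = f n i - lower_terms \<tau> v i"
        "(w (i + 1) - 2 *\<^sub>R w i + w (i - 1)) /\<^sub>R \<tau>\<^sup>2 + a1 *\<^sub>R B ((w (i + 1) - w (i - 1)) /\<^sub>R (2 * \<tau>))
        + a2 *\<^sub>R B ((w (i + 1) + w (i - 1)) /\<^sub>R 2) = fbar n i - lower_terms \<tau> w i"
        unfolding eq_diff_eq scheme_lhs_eq[symmetric] v_def w_def \<tau>_def
        using sol n(2) i unfolding solves_scheme_def by blast+
      \<comment> \<open>\<open>B\<close> is linear only on \<open>DB\<close>, so its arguments are
        first written as differences of elements of \<open>DB\<close>.\<close>
      have Bz: "B ((z (i + 1) - z (i - 1)) /\<^sub>R (2 * \<tau>)) = B ((v (i + 1) - v (i - 1)) /\<^sub>R (2 * \<tau>))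
          - B ((w (i + 1) - w (i - 1)) /\<^sub>R (2 * \<tau>))"
        "B ((z (i + 1) + z (i - 1)) /\<^sub>R 2) = B ((v (i + 1) + v (i - 1)) /\<^sub>R 2) - B ((w (i + 1) + w (i - 1)) /\<^sub>R 2)"
      proof -
        note dv = vw(1)[OF i1(3)] vw(1)[OF i1(4)] vw(2)[OF i1(3)] vw(2)[OF i1(4)]
        have "(z (i + 1) - z (i - 1)) /\<^sub>R (2 * \<tau>) = (v (i + 1) - v (i - 1)) /\<^sub>R (2 * \<tau>) - (w (i + 1) - w (i - 1)) /\<^sub>R (2 * \<tau>)"
          "(z (i + 1) + z (i - 1)) /\<^sub>R 2 = (v (i + 1) + v (i - 1)) /\<^sub>R 2 - (w (i + 1) + w (i - 1)) /\<^sub>R 2"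
          unfolding z_def by (simp_all only: scaleR_diff_right[symmetric]) (simp_all add: algebra_simps)
        then show "B ((z (i + 1) - z (i - 1)) /\<^sub>R (2 * \<tau>)) = B ((v (i + 1) - v (i - 1)) /\<^sub>R (2 * \<tau>))
            - B ((w (i + 1) - w (i - 1)) /\<^sub>R (2 * \<tau>))"
          "B ((z (i + 1) + z (i - 1)) /\<^sub>R 2) = B ((v (i + 1) + v (i - 1)) /\<^sub>R 2) - B ((w (i + 1) + w (i - 1)) /\<^sub>R 2)"
          using linear_operator_simps(7)[OF lin_B] DB_closed dv by (simp_all only:)
      qed
      have "(z (i + 1) - 2 *\<^sub>R z i + z (i - 1)) /\<^sub>R \<tau>\<^sup>2 =
        (v (i + 1) - 2 *\<^sub>R v i + v (i - 1)) /\<^sub>R \<tau>\<^sup>2 - (w (i + 1) - 2 *\<^sub>R w i + w (i - 1)) /\<^sub>R \<tau>\<^sup>2"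
        unfolding z_def by (simp only: scaleR_diff_right[symmetric]) (simp add: algebra_simps)
      then have "(z (i + 1) - 2 *\<^sub>R z i + z (i - 1)) /\<^sub>R \<tau>\<^sup>2 + a1 *\<^sub>R B ((z (i + 1) - z (i - 1)) /\<^sub>R (2 * \<tau>))
        + a2 *\<^sub>R B ((z (i + 1) + z (i - 1)) /\<^sub>R 2) = (f n i - lower_terms \<tau> v i) - (fbar n i - lower_terms \<tau> w i)"
        unfolding Bz eqs[symmetric] scaleR_diff_right[of a1] scaleR_diff_right[of a2] by (simp only: add_diff_add)
      then show "(z (i + 1) - 2 *\<^sub>R z i + z (i - 1)) /\<^sub>R \<tau>\<^sup>2 + a1 *\<^sub>R B ((z (i + 1) - z (i - 1)) /\<^sub>R (2 * \<tau>))
        + a2 *\<^sub>R B ((z (i + 1) + z (i - 1)) /\<^sub>R 2) + 0 = g i"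
        by (simp only: add_0_right) (simp add: g_def)
      have "norm (lower_terms \<tau> v i - lower_terms \<tau> w i)
        \<le> c * (\<lblot>z (i + 1)\<rblot> + \<lblot>z i\<rblot> + \<lblot>z (i - 1)\<rblot> + norm (velocity \<tau> z i) + norm (velocity \<tau> z (i - 1)))"
        unfolding z_def
      proof (rule c(2)[OF i1(1) \<tau>(1)])
        show "\<forall>j\<in>{i - 1, i, i + 1}. v j \<in> DB \<and> w j \<in> DB \<and> \<lblot>v j\<rblot> \<le> K \<and> \<lblot>w j\<rblot> \<le> K"
          using vw[OF i1(2)] vw[OF i1(3)] vw[OF i1(4)] by blast
        show "\<forall>j\<in>{i - 1, i}. norm (velocity \<tau> v j) \<le> K \<and> norm (velocity \<tau> w j) \<le> K"
          using vel[OF i1(6)] vel[OF i1(7)] by blast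
      qed
      then show "norm (g i) \<le> \<phi> i + c * (\<lblot>z (i + 1)\<rblot> + \<lblot>z i\<rblot> + \<lblot>z (i - 1)\<rblot>
        + norm (velocity \<tau> z i) + norm (velocity \<tau> z (i - 1)))"
        unfolding g_def \<phi>_def by (rule order_trans[OF norm_triangle_ineq4 add_left_mono])
    qed (use \<tau> c(1) z k \<phi>_def in auto)
    then have est: "\<lblot>z (k + 1)\<rblot> + norm (velocity \<tau> z k) \<le> G * (sqrt E0 + 2 * \<tau> * (\<Sum>i=1..k. \<phi> i))"
      unfolding G_def using norm_ge_zero[of "sqrt_operator DB B (z k)"] by linarith
    have z01: "z 0 \<in> DB" "z 1 \<in> DB" using z n(2) by auto
    have "\<lblot>z 1\<rblot> \<le> \<lblot>z 0\<rblot> + \<tau> * \<lblot>velocity \<tau> z 0\<rblot>"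
    proof -
      \<comment> \<open>The initial energy contains the energy norm of \<open>z 1\<close>;
        expressing it through \<open>z 0\<close> and the first velocity produces the term with
        \<open>\<tau>\<close> on the right of the estimate.\<close>
      have "z 1 = z 0 + \<tau> *\<^sub>R velocity \<tau> z 0" using \<tau>(1) by simp
      moreover have "velocity \<tau> z 0 \<in> DB" using z01 DB_closed by simp
      ultimately show ?thesis
        using energy_norm_linear(1)[OF z01(1) DB_closed(3)[OF \<open>velocity \<tau> z 0 \<in> DB\<close>], of \<tau>]
          energy_norm_linear(2)[OF \<open>velocity \<tau> z 0 \<in> DB\<close>, of \<tau>] \<tau>(1) by simp
    qed
    then have "\<sigma> * (\<lblot>z 1\<rblot> + \<lblot>z 0\<rblot>) \<le> \<sigma> * (\<lblot>z 0\<rblot> + \<tau> * \<lblot>velocity \<tau> z 0\<rblot> + \<lblot>z 0\<rblot>)"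
      using \<sigma> by (intro mult_left_mono add_right_mono)
    moreover have "sqrt E0 \<le> norm (velocity \<tau> z 0) + \<sigma> * (\<lblot>z 1\<rblot> + \<lblot>z 0\<rblot>)"
      unfolding E0_def add_0_right \<sigma>_def using a2 by (intro sqrt_sum_squares_le) auto
    ultimately have "sqrt E0 + 2 * \<tau> * (\<Sum>i=1..k. \<phi> i) \<le> norm (velocity \<tau> z 0)
      + \<sigma> * (\<lblot>z 0\<rblot> + \<tau> * \<lblot>velocity \<tau> z 0\<rblot> + \<lblot>z 0\<rblot>) + 2 * (\<tau> * (\<Sum>i=1..k. \<phi> i))" by simp
    also have "\<dots> \<le> (2 + 2 * \<sigma>) * (\<lblot>z 0\<rblot> + norm (velocity \<tau> z 0) + \<tau> * \<lblot>velocity \<tau> z 0\<rblot>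
      + \<tau> * (\<Sum>i=1..k. \<phi> i))"
    proof -
      have nonneg: "0 \<le> \<tau> * \<lblot>velocity \<tau> z 0\<rblot>" "0 \<le> \<tau> * (\<Sum>i=1..k. \<phi> i)"
        using \<tau>(1) by (simp_all add: \<phi>_def sum_nonneg)
      have aux: "p + \<sigma> * (x + y + x) + 2 * q \<le> (2 + 2 * \<sigma>) * (x + p + y + q)"
        if "0 \<le> x" "0 \<le> y" "0 \<le> p" "0 \<le> q" for x y p q :: real
      proof -
        have "0 \<le> \<sigma> * p" "0 \<le> \<sigma> * y" "0 \<le> \<sigma> * q" using that \<sigma> by simp_all
        then show ?thesis using that by (simp add: algebra_simps)
      qed
      show ?thesis by (rule aux) (use nonneg in auto)
    qed
    finally have "G * (sqrt E0 + 2 * \<tau> * (\<Sum>i=1..k. \<phi> i)) \<le> G * ((2 + 2 * \<sigma>) *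
      (\<lblot>z 0\<rblot> + norm (velocity \<tau> z 0) + \<tau> * \<lblot>velocity \<tau> z 0\<rblot> + \<tau> * (\<Sum>i=1..k. \<phi> i)))"
      using G by (intro mult_left_mono) auto
    then show ?thesis using order_trans[OF est]
      unfolding mult.assoc \<phi>_def z_def v_def w_def \<tau>_def by blast
  qed
  moreover have "0 < G * (2 + 2 * \<sigma>)" using G \<sigma> by simp
  ultimately show ?thesis by blast
qed

end

theorem theorem5p1:
  fixes A B C N M :: "'a::{real_inner, banach} \<Rightarrow> 'a"
    and DA DB DC :: "'a set"
    and \<psi>1 \<psi>2 \<psi>3 :: "real \<Rightarrow> real"
    and a0 a1 a2 b0 T :: real
    and u ubar f fbar :: "nat \<Rightarrow> nat \<Rightarrow> 'a"
  assumes "T > 0"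
    and "self_adjoint DA A" and "positively_defined DA A"
    and "self_adjoint DB B" and "positively_defined DB B"
    and "DB \<subseteq> DA"
    and "b0 > 0" and "\<And>v. v \<in> DB \<Longrightarrow> (norm (A v))\<^sup>2 \<le> b0\<^sup>2 * inner (B v) v"
    and "C2_on {0..} \<psi>1" and "\<And>s. s \<ge> 0 \<Longrightarrow> \<psi>1 s \<ge> 0"
    and "C2_on {0..} \<psi>2" and "\<And>s. s \<ge> 0 \<Longrightarrow> \<psi>2 s \<ge> 0" and "mono_on {0..} \<psi>2"
    and "C2_on {0..} \<psi>3" and "\<And>s. s \<ge> 0 \<Longrightarrow> \<psi>3 s \<ge> 0"
    and "linear_operator DC C" and "DA \<subseteq> DC"
    and "a0 > 0" and "\<And>v. v \<in> DA \<Longrightarrow> norm (C v) \<le> a0 * norm (A v)"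
    and "bounded_linear N"
    and "\<exists>L. L-lipschitz_on UNIV M"
    and "a1 > 0" and "a2 > 0"
    and "solves_scheme \<psi>1 \<psi>2 \<psi>3 a1 a2 DA A DB B C N M T u f"
    and "solves_scheme \<psi>1 \<psi>2 \<psi>3 a1 a2 DA A DB B C N M T ubar fbar"
    and "bounded_data DB B T u f"
    and "bounded_data DB B T ubar fbar"
  shows "\<exists>c>0. \<exists>n0. \<forall>n\<ge>n0. n > 1 \<longrightarrow>
    (let \<tau> = T / real n; z = (\<lambda>k. u n k - ubar n k); \<Delta>z = (\<lambda>k. z (k + 1) - z k) in
      \<forall>k\<in>{1..n - 1}.
        norm (sqrt_operator DB B (z (k + 1))) + norm (\<Delta>z k /\<^sub>R \<tau>)
        \<le> c * (norm (sqrt_operator DB B (z 0)) + norm (\<Delta>z 0 /\<^sub>R \<tau>)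
               + \<tau> * norm (sqrt_operator DB B (\<Delta>z 0 /\<^sub>R \<tau>))
               + \<tau> * (\<Sum>i=1..k. norm (f n i - fbar n i))))"
proof -
  interpret nonlinear_scheme A B C N M DA DB DC \<psi>1 \<psi>2 \<psi>3 a0 a1 a2 b0
    by (rule nonlinear_scheme.intro) (fact assms)+
  show ?thesis using stability[OF assms(1) assms(24,25,26,27)] unfolding Let_def by simp
qed

end
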